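(* Let $A, L, F, M, G\in K[D]$ with $\gcd(\operatorname{Sym}(F),\operatorname{Sym}(M))=1$. (i) If $L\circ F = A = M\circ G$, then there exists $N\in K[D]$ such that $A = M\circ N\circ F$. (ii) If $F\circ L = A = G\circ M$, then there exists $N\in K[D]$ such that $A = F\circ N\circ M$.
   Context: $K$ is a field of characteristic zero with commuting derivations $\partial_1,\dots,\partial_n$. $K[D]=K[D_1,\dots,D_n]$ is the corresponding non-commutative ring of linear partial differential operators (LPDOs): the $D_i$ commute with each other, and $D_i\circ f = f D_i + \partial_i(f)$ for $f\in K$; multiplication in $K[D]$ is written $\circ$. Every nonzero $L\in K[D]$ has the form $L=\sum_{|J|\le d} a_J D^J$ with $a_J\in K$, where $J=(j_1,\dots,j_n)\in\mathbb{N}^n$, $|J|=j_1+\dots+j_n$, $D^J=D_1^{j_1}\cdots D_n^{j_n}$, and $a_J\neq 0$ for some $J$ with $|J|=d$; $d$ is the order of $L$. The (principal) symbol of $L$ is the homogeneous commutative polynomial $\operatorname{Sym}(L)=\sum_{|J|=d}a_J X^J\in K[X]=K[X_1,\dots,X_n]$, and $\operatorname{Sym}(0)=0$. The gcd is taken in the commutative polynomial ring $K[X_1,\dots,X_n]$. *)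

theory Defs
  imports "HOL-Library.Poly_Mapping"
begin

text \<open>
  The index set of the derivations is the finite type \<open>'n\<close> (so \<open>n = CARD('n)\<close>), a multi-index is a
  finitely supported function \<open>J :: 'n \<Rightarrow>\<^sub>0 nat\<close>, and both \<open>K[D]\<close> and \<open>K[X]\<close> consist of the finitely
  supported families of coefficients \<open>J \<mapsto> a\<^sub>J\<close>.  On \<open>('n, 'k) mpoly\<close> the product of \<open>Poly_Mapping\<close>
  is that of the commutative ring \<open>K[X]\<close>; the composition of operators is a different product,
  \<open>lpdo_mult\<close> below, which depends on the derivations.
\<close>

type_synonym ('n, 'k) mpoly = "('n \<Rightarrow>\<^sub>0 nat) \<Rightarrow>\<^sub>0 'k"

type_synonym ('n, 'k) lpdo = "('n \<Rightarrow>\<^sub>0 nat) \<Rightarrow>\<^sub>0 'k"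

locale commuting_derivations =
  fixes d :: "'n::finite \<Rightarrow> 'k::field_char_0 \<Rightarrow> 'k"
  assumes deriv_add: "d i (a + b) = d i a + d i b"
    and deriv_mult: "d i (a * b) = d i a * b + a * d i b"
    and deriv_commute: "d i (d j a) = d j (d i a)"

text \<open>
  Left multiplication by \<open>D\<^sub>i\<close>, as forced by \<open>D\<^sub>i \<circ> f = f D\<^sub>i + \<partial>\<^sub>i(f)\<close>:
  \<open>D\<^sub>i \<circ> (\<Sum> b\<^sub>J D\<^sup>J) = \<Sum> b\<^sub>J D\<^sub>i D\<^sup>J + \<Sum> \<partial>\<^sub>i(b\<^sub>J) D\<^sup>J\<close>.
\<close>

definition lpdo_D_left ::
    "('n \<Rightarrow> 'k::field_char_0 \<Rightarrow> 'k) \<Rightarrow> 'n \<Rightarrow> ('n, 'k) lpdo \<Rightarrow> ('n, 'k) lpdo" where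
  "lpdo_D_left d i M =
     Poly_Mapping.single (Poly_Mapping.single i 1) 1 * M + Poly_Mapping.map (d i) M"

text \<open>
  Left multiplication by \<open>D\<^sup>J\<close>.  The maps \<open>lpdo_D_left d i\<close> commute for commuting derivations, so
  the fold does not depend on the order of the indices.
\<close>

definition lpdo_DJ_left ::
    "('n::finite \<Rightarrow> 'k::field_char_0 \<Rightarrow> 'k) \<Rightarrow> ('n \<Rightarrow>\<^sub>0 nat) \<Rightarrow> ('n, 'k) lpdo \<Rightarrow> ('n, 'k) lpdo" where
  "lpdo_DJ_left d J M = Finite_Set.fold (\<lambda>i. lpdo_D_left d i ^^ Poly_Mapping.lookup J i) M UNIV"

definition lpdo_mult ::
    "('n, 'k) lpdo \<Rightarrow> ('n::finite \<Rightarrow> 'k::field_char_0 \<Rightarrow> 'k) \<Rightarrow> ('n, 'k) lpdo \<Rightarrow> ('n, 'k) lpdo"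
    (\<open>(_ \<circ>\<^bsub>_\<^esub> _)\<close> [70, 0, 71] 70) where
  "L \<circ>\<^bsub>d\<^esub> M =
     (\<Sum>J\<in>Poly_Mapping.keys L. Poly_Mapping.map ((*) (Poly_Mapping.lookup L J)) (lpdo_DJ_left d J M))"

definition multi_degree :: "('n::finite \<Rightarrow>\<^sub>0 nat) \<Rightarrow> nat" where
  "multi_degree J = (\<Sum>i\<in>UNIV. Poly_Mapping.lookup J i)"

text \<open>Meaningful only for \<open>L \<noteq> 0\<close>.\<close>

definition lpdo_order :: "('n::finite, 'k::field_char_0) lpdo \<Rightarrow> nat" where
  "lpdo_order L = Max (multi_degree ` Poly_Mapping.keys L)"

definition lpdo_symbol :: "('n::finite, 'k::field_char_0) lpdo \<Rightarrow> ('n, 'k) mpoly" where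
  "lpdo_symbol L =
     (\<Sum>J | J \<in> Poly_Mapping.keys L \<and> multi_degree J = lpdo_order L.
        Poly_Mapping.single J (Poly_Mapping.lookup L J))"

lemma lpdo_symbol_zero: "lpdo_symbol 0 = 0"
  by (simp add: lpdo_symbol_def)


text \<open>
  The remaining lemmas confirm that \<open>lpdo_mult\<close> is the product of \<open>K[D]\<close>: it is associative,
  bilinear and unital, satisfies the defining relations, and makes the family \<open>J \<mapsto> a\<^sub>J\<close>
  represent \<open>\<Sum> a\<^sub>J D\<^sup>J\<close>.
\<close>

lemma lookup_map_scale:
  fixes L :: "'a \<Rightarrow>\<^sub>0 'k::field_char_0"
  shows "Poly_Mapping.lookup (Poly_Mapping.map ((*) a) L) J = a * Poly_Mapping.lookup L J"
  by (simp add: Poly_Mapping.map.rep_eq when_def)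

lemma map_scale_add:
  fixes L M :: "'a \<Rightarrow>\<^sub>0 'k::field_char_0"
  shows "Poly_Mapping.map ((*) a) (L + M) = Poly_Mapping.map ((*) a) L + Poly_Mapping.map ((*) a) M"
  by (rule poly_mapping_eqI) (simp add: lookup_map_scale lookup_add algebra_simps)

lemma map_scale_add_left:
  fixes L :: "'a \<Rightarrow>\<^sub>0 'k::field_char_0"
  shows "Poly_Mapping.map ((*) (a + b)) L = Poly_Mapping.map ((*) a) L + Poly_Mapping.map ((*) b) L"
  by (rule poly_mapping_eqI) (simp add: lookup_map_scale lookup_add algebra_simps)

lemma map_scale_scale:
  fixes L :: "'a \<Rightarrow>\<^sub>0 'k::field_char_0"
  shows "Poly_Mapping.map ((*) a) (Poly_Mapping.map ((*) b) L) = Poly_Mapping.map ((*) (a * b)) L"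
  by (rule poly_mapping_eqI) (simp add: lookup_map_scale algebra_simps)

lemma map_scale_zero: "Poly_Mapping.map ((*) 0) L = (0 :: 'a \<Rightarrow>\<^sub>0 'k::field_char_0)"
  by (rule poly_mapping_eqI) (simp add: lookup_map_scale)

lemma map_scale_one: "Poly_Mapping.map ((*) 1) L = (L :: 'a \<Rightarrow>\<^sub>0 'k::field_char_0)"
  by (rule poly_mapping_eqI) (simp add: lookup_map_scale)

lemma mult_map_scale:
  fixes L P :: "('n, 'k::field_char_0) mpoly"
  shows "P * Poly_Mapping.map ((*) a) L = Poly_Mapping.map ((*) a) (P * L)"
  by (simp add: mult_map_scale_conv_mult mult.left_commute)

lemma lpdo_induct [case_names single add]:
  fixes L :: "'a \<Rightarrow>\<^sub>0 'k::field_char_0"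
  assumes single: "\<And>J a. P (Poly_Mapping.single J a)"
    and add: "\<And>L M. P L \<Longrightarrow> P M \<Longrightarrow> P (L + M)"
  shows "P L"
proof (induction L rule: update_induct)
  case const
  show ?case using single[of undefined 0] by simp
next
  case (update f a b)
  have "Poly_Mapping.update a b f = f + Poly_Mapping.single a b"
    using update(1)
    by (intro poly_mapping_eqI) (auto simp: lookup_update lookup_add lookup_single when_def in_keys_iff)
  then show ?case using update add single by simp
qed

lemma lpdo_mult_single_left:
  "Poly_Mapping.single J a \<circ>\<^bsub>d\<^esub> M = Poly_Mapping.map ((*) a) (lpdo_DJ_left d J M)"
  by (simp add: lpdo_mult_def map_scale_zero)

lemma lpdo_mult_add_left: "(L + M) \<circ>\<^bsub>d\<^esub> N = (L \<circ>\<^bsub>d\<^esub> N) + (M \<circ>\<^bsub>d\<^esub> N)"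
  unfolding lpdo_mult_def
  by (rule setsum_keys_plus_distrib) (simp_all only: map_scale_zero map_scale_add_left)

lemma lpdo_mult_scale_left:
  "Poly_Mapping.map ((*) a) L \<circ>\<^bsub>d\<^esub> M = Poly_Mapping.map ((*) a) (L \<circ>\<^bsub>d\<^esub> M)"
proof (induction L rule: lpdo_induct)
  case (single J b)
  show ?case by (simp add: lpdo_mult_single_left map_scale_scale)
next
  case (add L L')
  then show ?case by (simp add: map_scale_add lpdo_mult_add_left)
qed

context commuting_derivations
begin

lemma deriv_zero [simp]: "d i 0 = 0"
  using deriv_add[of i 0 0] by simp

lemma deriv_one [simp]: "d i 1 = 0"
  using deriv_mult[of i 1 1] by simp

lemma lookup_map_deriv:
  "Poly_Mapping.lookup (Poly_Mapping.map (d i) L) J = d i (Poly_Mapping.lookup L J)"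
  by (simp add: Poly_Mapping.map.rep_eq when_def)

lemma map_deriv_add:
  "Poly_Mapping.map (d i) (L + M) = Poly_Mapping.map (d i) L + Poly_Mapping.map (d i) M"
  by (rule poly_mapping_eqI) (simp add: lookup_map_deriv lookup_add deriv_add)

lemma map_deriv_scale:
  "Poly_Mapping.map (d i) (Poly_Mapping.map ((*) a) L) =
     Poly_Mapping.map ((*) (d i a)) L + Poly_Mapping.map ((*) a) (Poly_Mapping.map (d i) L)"
  by (rule poly_mapping_eqI) (simp add: lookup_map_deriv lookup_map_scale lookup_add deriv_mult)

lemma map_deriv_X_mult:
  "Poly_Mapping.map (d i) (Poly_Mapping.single J 1 * L) =
     Poly_Mapping.single J 1 * Poly_Mapping.map (d i) L"
  by (induction L rule: lpdo_induct) (simp_all add: mult_single map_deriv_add distrib_left)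

lemma D_left_add: "lpdo_D_left d i (L + M) = lpdo_D_left d i L + lpdo_D_left d i M"
  by (simp add: lpdo_D_left_def map_deriv_add algebra_simps)

lemma D_left_scale:
  "lpdo_D_left d i (Poly_Mapping.map ((*) a) L) =
     Poly_Mapping.map ((*) (d i a)) L + Poly_Mapping.map ((*) a) (lpdo_D_left d i L)"
  by (simp add: lpdo_D_left_def map_deriv_scale mult_map_scale map_scale_add add_ac)

lemma D_left_commute: "lpdo_D_left d i (lpdo_D_left d j L) = lpdo_D_left d j (lpdo_D_left d i L)"
proof -
  have "Poly_Mapping.map (d i) (Poly_Mapping.map (d j) L) =
        Poly_Mapping.map (d j) (Poly_Mapping.map (d i) L)"
    by (rule poly_mapping_eqI) (simp add: lookup_map_deriv deriv_commute)
  then show ?thesis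
    by (simp del: One_nat_def
        add: lpdo_D_left_def map_deriv_add map_deriv_X_mult distrib_left add_ac mult.left_commute)
qed

interpretation D: comp_fun_commute "lpdo_D_left d"
  by standard (auto simp: fun_eq_iff D_left_commute)

lemma comp_fun_commute_D_left_pow: "comp_fun_commute (\<lambda>i. lpdo_D_left d i ^^ k i)"
  by (rule D.comp_fun_commute_funpow)

lemma DJ_left_zero [simp]: "lpdo_DJ_left d 0 M = M"
proof -
  have "Finite_Set.fold (\<lambda>_ x. x) M A = M" if "finite A" for A :: "'n set"
  proof -
    interpret comp_fun_commute "\<lambda>(_::'n) (x :: ('n, 'k) lpdo). x" by standard simp
    show ?thesis using that by induction auto
  qed
  then show ?thesis by (simp add: lpdo_DJ_left_def id_def)
qed

lemma DJ_left_add_single: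
  "lpdo_DJ_left d (J + Poly_Mapping.single i 1) M = lpdo_D_left d i (lpdo_DJ_left d J M)"
proof -
  define k where "k = Poly_Mapping.lookup J"
  define k' where "k' = Poly_Mapping.lookup (J + Poly_Mapping.single i 1)"
  interpret k: comp_fun_commute "\<lambda>i. lpdo_D_left d i ^^ k i"
    by (rule comp_fun_commute_D_left_pow)
  interpret k': comp_fun_commute "\<lambda>i. lpdo_D_left d i ^^ k' i"
    by (rule comp_fun_commute_D_left_pow)
  let ?B = "UNIV - {i}"
  have k'_i: "k' i = Suc (k i)" and k'_other: "\<And>j. j \<noteq> i \<Longrightarrow> k' j = k j"
    by (simp_all add: k_def k'_def lookup_add lookup_single when_def)
  have "lpdo_DJ_left d (J + Poly_Mapping.single i 1) M =
        Finite_Set.fold (\<lambda>i. lpdo_D_left d i ^^ k' i) M UNIV"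
    by (simp add: lpdo_DJ_left_def k'_def)
  also have "\<dots> = (lpdo_D_left d i ^^ k' i) (Finite_Set.fold (\<lambda>i. lpdo_D_left d i ^^ k' i) M ?B)"
    by (rule k'.fold_rec) auto
  also have "Finite_Set.fold (\<lambda>i. lpdo_D_left d i ^^ k' i) M ?B =
        Finite_Set.fold (\<lambda>i. lpdo_D_left d i ^^ k i) M ?B"
    by (rule fold_closed_eq[where B = UNIV]) (auto simp: k'_other)
  also have "(lpdo_D_left d i ^^ k' i) (Finite_Set.fold (\<lambda>i. lpdo_D_left d i ^^ k i) M ?B) =
        lpdo_D_left d i ((lpdo_D_left d i ^^ k i) (Finite_Set.fold (\<lambda>i. lpdo_D_left d i ^^ k i) M ?B))"
    by (simp add: k'_i)
  also have "(lpdo_D_left d i ^^ k i) (Finite_Set.fold (\<lambda>i. lpdo_D_left d i ^^ k i) M ?B) =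
        Finite_Set.fold (\<lambda>i. lpdo_D_left d i ^^ k i) M UNIV"
    by (rule k.fold_rec[symmetric]) auto
  finally show ?thesis by (simp add: lpdo_DJ_left_def k_def)
qed

lemma multi_index_induct [case_names zero step]:
  fixes J :: "'n \<Rightarrow>\<^sub>0 nat"
  assumes zero: "P 0"
    and step: "\<And>J i. P J \<Longrightarrow> P (J + Poly_Mapping.single i 1)"
  shows "P J"
proof (induction "multi_degree J" arbitrary: J)
  case 0
  then have "J = 0" by (intro poly_mapping_eqI) (simp add: multi_degree_def)
  then show ?case using zero by simp
next
  case (Suc m)
  then obtain i where i: "Poly_Mapping.lookup J i > 0"
    by (metis bot_nat_0.not_eq_extremum multi_degree_def nat.distinct(1) sum.neutral)
  define J' where "J' = J - Poly_Mapping.single i 1"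
  have J: "J = J' + Poly_Mapping.single i 1"
    using i by (intro poly_mapping_eqI)
      (auto simp: J'_def lookup_add lookup_minus lookup_single when_def)
  then have "multi_degree J = multi_degree J' + 1"
    by (simp add: multi_degree_def lookup_add sum.distrib lookup_single when_def)
  then have "P J'" using Suc by simp
  then show ?case using step J by metis
qed

lemma DJ_left_add: "lpdo_DJ_left d J (L + M) = lpdo_DJ_left d J L + lpdo_DJ_left d J M"
  by (induction J rule: multi_index_induct)
    (simp_all del: One_nat_def add: DJ_left_add_single D_left_add)

lemma DJ_left_X: "lpdo_DJ_left d J (Poly_Mapping.single I 1) = Poly_Mapping.single (I + J) 1"
  by (induction J rule: multi_index_induct)
    (simp_all del: One_nat_def
      add: DJ_left_add_single lpdo_D_left_def mult_single add.assoc add.commute add.left_commute)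

lemma lpdo_mult_add_right: "L \<circ>\<^bsub>d\<^esub> (M + N) = (L \<circ>\<^bsub>d\<^esub> M) + (L \<circ>\<^bsub>d\<^esub> N)"
  by (simp add: lpdo_mult_def DJ_left_add map_scale_add sum.distrib)

lemma D_left_mult: "lpdo_D_left d i L \<circ>\<^bsub>d\<^esub> M = lpdo_D_left d i (L \<circ>\<^bsub>d\<^esub> M)"
proof (induction L rule: lpdo_induct)
  case (single J a)
  have "lpdo_D_left d i (Poly_Mapping.single J a) =
        Poly_Mapping.single (J + Poly_Mapping.single i 1) a + Poly_Mapping.single J (d i a)"
    by (simp add: lpdo_D_left_def mult_single add.commute)
  then show ?case
    by (simp del: One_nat_def add: lpdo_mult_add_left lpdo_mult_single_left DJ_left_add_single
        D_left_scale add.commute)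
next
  case (add L L')
  then show ?case by (simp add: D_left_add lpdo_mult_add_left)
qed

lemma DJ_left_mult: "lpdo_DJ_left d J L \<circ>\<^bsub>d\<^esub> M = lpdo_DJ_left d J (L \<circ>\<^bsub>d\<^esub> M)"
  by (induction J rule: multi_index_induct)
    (simp_all del: One_nat_def add: DJ_left_add_single D_left_mult)

theorem lpdo_mult_assoc: "(L \<circ>\<^bsub>d\<^esub> M) \<circ>\<^bsub>d\<^esub> N = L \<circ>\<^bsub>d\<^esub> (M \<circ>\<^bsub>d\<^esub> N)"
proof (induction L rule: lpdo_induct)
  case (single J a)
  show ?case by (simp add: lpdo_mult_single_left lpdo_mult_scale_left DJ_left_mult)
next
  case (add L L')
  then show ?case by (simp add: lpdo_mult_add_left)
qed

lemma lpdo_mult_one_left: "1 \<circ>\<^bsub>d\<^esub> L = L"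
  using lpdo_mult_single_left[of 0 1 d L] by (simp add: map_scale_one)

lemma lpdo_mult_one_right: "L \<circ>\<^bsub>d\<^esub> 1 = L"
proof (induction L rule: lpdo_induct)
  case (single J a)
  show ?case using DJ_left_X[of J 0] by (simp add: lpdo_mult_single_left)
next
  case (add L L')
  then show ?case by (simp add: lpdo_mult_add_left)
qed

abbreviation (input) const :: "'k \<Rightarrow> ('n, 'k) lpdo" where
  "const f \<equiv> Poly_Mapping.single 0 f"

abbreviation (input) D :: "'n \<Rightarrow> ('n, 'k) lpdo" where
  "D i \<equiv> Poly_Mapping.single (Poly_Mapping.single i 1) 1"

lemma D_mult: "D i \<circ>\<^bsub>d\<^esub> L = lpdo_D_left d i L"
  using DJ_left_add_single[of 0 i] by (simp add: lpdo_mult_single_left map_scale_one)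

lemma const_mult: "const f \<circ>\<^bsub>d\<^esub> L = Poly_Mapping.map ((*) f) L"
  by (simp add: lpdo_mult_single_left)

lemma const_mult_const: "const f \<circ>\<^bsub>d\<^esub> const g = const (f * g)"
  by (simp add: const_mult)

lemma D_mult_const: "D i \<circ>\<^bsub>d\<^esub> const f = (const f \<circ>\<^bsub>d\<^esub> D i) + const (d i f)"
  by (simp del: One_nat_def add: D_mult const_mult lpdo_D_left_def mult_single)

lemma D_mult_commute: "D i \<circ>\<^bsub>d\<^esub> D j = D j \<circ>\<^bsub>d\<^esub> D i"
  by (simp del: One_nat_def add: D_mult lpdo_D_left_def mult_single add.commute)

lemma D_mult_DJ:
  "D i \<circ>\<^bsub>d\<^esub> Poly_Mapping.single J 1 = Poly_Mapping.single (J + Poly_Mapping.single i 1) 1"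
  by (simp del: One_nat_def add: D_mult lpdo_D_left_def mult_single add.commute)

lemma lpdo_normal_form:
  "L = (\<Sum>J\<in>Poly_Mapping.keys L. const (Poly_Mapping.lookup L J) \<circ>\<^bsub>d\<^esub> Poly_Mapping.single J 1)"
  by (rule poly_mapping_eqI)
    (simp add: const_mult lookup_sum lookup_single when_def in_keys_iff)

end

end

theory Submission
  imports Defs "HOL-Computational_Algebra.Polynomial"
begin

text \<open>
  The two parts are the same statement with the letters renamed, because the condition on the
  symbols is symmetric; so suppose \<open>L \<circ> F = M \<circ> G\<close>, with \<open>F\<close> and \<open>M\<close> nonzero because otherwise
  both sides vanish.  The idea is to divide \<open>L\<close> by \<open>M\<close> and \<open>G\<close> by
  \<open>F\<close> simultaneously, one order at a time.  Symbols are multiplicative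
  (\<open>hom_part_lpdo_mult\<close>), so \<open>Sym L * Sym F = Sym M * Sym G\<close>, and as \<open>Sym M\<close> is coprime to
  \<open>Sym F\<close> it divides \<open>Sym L\<close> (\<open>symbol_dvd\<close>).  Let \<open>N\<close> be the homogeneous quotient, read as an
  operator.  Then \<open>L - M \<circ> N\<close> has smaller order than \<open>L\<close>, and
  \<open>(L - M \<circ> N) \<circ> F = M \<circ> (G - N \<circ> F)\<close> is an equation of the same shape.  By induction its value is
  \<open>M \<circ> N' \<circ> F\<close>, whence \<open>L \<circ> F = M \<circ> (N + N') \<circ> F\<close> (\<open>common_multiple_factors\<close>).

  The one substantial ingredient is commutative: in \<open>K[X\<^sub>1, \<dots>, X\<^sub>n]\<close>, if \<open>a\<close> divides \<open>c * b\<close> and has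
  only unit factors in common with \<open>b\<close>, then \<open>a\<close> divides \<open>c\<close> (\<open>coprime_dvd_mult\<close>).  This is unique
  factorization, proved by adjoining the variables one by one (Gauss's lemma).  The ring of
  polynomials in the variables from a set \<open>V\<close> is a subset of a type, not a type of its own, so
  divisibility, primes and factorization are taken relative to a subring \<open>S\<close> of a
  commutative ring.  The Gauss step passes from \<open>S\<close> to the univariate polynomials with coefficients
  in \<open>S\<close> (\<open>factorial_subring_polys_over\<close>); evaluation at a new variable carries these injectively
  into \<open>K[X\<^sub>1, \<dots>, X\<^sub>n]\<close> (\<open>factorial_subring_image\<close>, \<open>poly_var_eq_0D\<close>).
\<close>

section \<open>Factorial subrings\<close>

definition dvd_in :: "'a::comm_ring_1 set \<Rightarrow> 'a \<Rightarrow> 'a \<Rightarrow> bool" where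
  "dvd_in S a b \<longleftrightarrow> (\<exists>c\<in>S. b = a * c)"

definition prime_in :: "'a::comm_ring_1 set \<Rightarrow> 'a \<Rightarrow> bool" where
  "prime_in S p \<longleftrightarrow> p \<in> S \<and> p \<noteq> 0 \<and> \<not> dvd_in S p 1 \<and>
     (\<forall>a\<in>S. \<forall>b\<in>S. dvd_in S p (a * b) \<longrightarrow> dvd_in S p a \<or> dvd_in S p b)"

text \<open>
  Unique factorization is the statement that every nonzero element is a unit times a product of
  primes, since primality forces uniqueness.  The induction rule of this set is what lets a
  constant factor be cancelled prime by prime.
\<close>

inductive_set prime_products :: "'a::comm_ring_1 set \<Rightarrow> 'a set" for S where
  unit: "u \<in> S \<Longrightarrow> dvd_in S u 1 \<Longrightarrow> u \<in> prime_products S"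
| prime: "prime_in S p \<Longrightarrow> a \<in> prime_products S \<Longrightarrow> p * a \<in> prime_products S"

locale subdomain =
  fixes S :: "'a::comm_ring_1 set"
  assumes zero_mem: "0 \<in> S"
    and one_mem: "1 \<in> S"
    and add_mem: "a \<in> S \<Longrightarrow> b \<in> S \<Longrightarrow> a + b \<in> S"
    and minus_mem: "a \<in> S \<Longrightarrow> - a \<in> S"
    and mult_mem: "a \<in> S \<Longrightarrow> b \<in> S \<Longrightarrow> a * b \<in> S"
    and no_zero_divisors: "a \<in> S \<Longrightarrow> b \<in> S \<Longrightarrow> a * b = 0 \<Longrightarrow> a = 0 \<or> b = 0"

locale factorial_subring = subdomain +
  assumes factorization: "a \<in> S \<Longrightarrow> a \<noteq> 0 \<Longrightarrow> a \<in> prime_products S"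

context subdomain
begin

lemma diff_mem: "a \<in> S \<Longrightarrow> b \<in> S \<Longrightarrow> a - b \<in> S"
  using add_mem[of a "- b"] minus_mem[of b] by simp

lemma sum_mem: "(\<And>x. x \<in> A \<Longrightarrow> f x \<in> S) \<Longrightarrow> sum f A \<in> S"
  by (induction A rule: infinite_finite_induct) (auto intro: zero_mem add_mem)

lemma dvd_in_diff: "dvd_in S a b \<Longrightarrow> dvd_in S a c \<Longrightarrow> dvd_in S a (b - c)"
  unfolding dvd_in_def by (metis diff_mem right_diff_distrib)

lemma dvd_in_add: "dvd_in S a b \<Longrightarrow> dvd_in S a c \<Longrightarrow> dvd_in S a (b + c)"
  unfolding dvd_in_def by (metis add_mem distrib_left)

lemma dvd_in_mult: "dvd_in S a b \<Longrightarrow> c \<in> S \<Longrightarrow> dvd_in S a (b * c)"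
  unfolding dvd_in_def by (metis mult_mem mult.assoc)

lemma mult_cancel:
  assumes "c \<in> S" "a \<in> S" "b \<in> S" "c \<noteq> 0" "c * a = c * b"
  shows "a = b"
  using no_zero_divisors[of c "a - b"] assms by (auto simp: diff_mem right_diff_distrib)

lemma prime_products_nonzero: "a \<in> prime_products S \<Longrightarrow> a \<in> S \<and> a \<noteq> 0"
  by (induction rule: prime_products.induct)
    (use no_zero_divisors in \<open>fastforce simp: dvd_in_def prime_in_def intro: mult_mem\<close>)+

lemma unit_mult_prime_products:
  assumes "u \<in> S" "dvd_in S u 1" "b \<in> prime_products S"
  shows "u * b \<in> prime_products S"
  using assms(3)
proof (induction rule: prime_products.induct)
  case (unit v)
  then obtain v' where v': "v' \<in> S" "1 = v * v'" by (auto simp: dvd_in_def)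
  obtain u' where u': "u' \<in> S" "1 = u * u'" using assms by (auto simp: dvd_in_def)
  have "1 = (u * v) * (u' * v')"
    using u'(2) v'(2) by (metis mult.assoc mult.left_commute mult_1_right)
  then have "dvd_in S (u * v) 1" using u' v' mult_mem by (auto simp: dvd_in_def)
  then show ?case using unit assms(1) by (intro prime_products.unit mult_mem)
next
  case (prime p a)
  then have "p * (u * a) \<in> prime_products S" by (simp only: prime_products.prime)
  then show ?case by (simp add: mult.left_commute)
qed

lemma mult_prime_products:
  assumes "a \<in> prime_products S" "b \<in> prime_products S"
  shows "a * b \<in> prime_products S"
  using assms(1)
proof (induction rule: prime_products.induct)
  case (unit u)
  then show ?case using assms(2) by (rule unit_mult_prime_products)
next
  case (prime p a)
  then show ?case by (simp add: mult.assoc prime_products.prime)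
qed

lemma prime_in_prime_products: "prime_in S p \<Longrightarrow> p \<in> prime_products S"
  using prime_products.prime[of S p 1] prime_products.unit[of 1 S]
  by (force simp: dvd_in_def intro: one_mem)

end

text \<open>
  An injective ring homomorphism is an isomorphism onto its image, so all relative notions are
  transported.
\<close>

lemma factorial_subring_image:
  fixes h :: "'a::comm_ring_1 \<Rightarrow> 'b::comm_ring_1"
  assumes "factorial_subring S"
    and h_add: "\<And>x y. h (x + y) = h x + h y" and h_mult: "\<And>x y. h (x * y) = h x * h y"
    and h_one: "h 1 = 1" and h_inj: "\<And>x. x \<in> S \<Longrightarrow> h x = 0 \<Longrightarrow> x = 0"
  shows "factorial_subring (h ` S)"
proof -
  interpret factorial_subring S by fact
  have h_zero: "h 0 = 0" using h_add[of 0 0] by simp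
  have h_minus: "h (- x) = - h x" for x
    using h_add[of x "- x"] by (simp add: h_zero add_eq_0_iff)
  have h_eq: "x = y" if "x \<in> S" "y \<in> S" "h x = h y" for x y
  proof -
    have "h (x + - y) = 0" using that(3) by (simp only: h_add h_minus) simp
    then show ?thesis using h_inj[of "x - y"] that diff_mem by simp
  qed
  interpret I: subdomain "h ` S"
  proof
    show "0 \<in> h ` S" "1 \<in> h ` S" using h_zero h_one zero_mem one_mem by (metis imageI)+
    fix a b assume "a \<in> h ` S" "b \<in> h ` S"
    then obtain x y where xy: "a = h x" "b = h y" "x \<in> S" "y \<in> S" by blast
    show "a + b \<in> h ` S" "a * b \<in> h ` S"
      using xy h_add h_mult add_mem mult_mem by (metis imageI)+
    show "a = 0 \<or> b = 0" if "a * b = 0"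
      using that xy h_inj[of "x * y"] mult_mem no_zero_divisors h_zero h_mult by metis
  next
    fix a assume "a \<in> h ` S"
    then show "- a \<in> h ` S" using h_minus minus_mem by (metis imageE imageI)
  qed
  have dvd: "dvd_in (h ` S) (h x) (h y) \<longleftrightarrow> dvd_in S x y" if xy: "x \<in> S" "y \<in> S" for x y
  proof
    assume "dvd_in (h ` S) (h x) (h y)"
    then obtain c where c: "c \<in> S" "h y = h (x * c)" by (auto simp: dvd_in_def h_mult)
    then have "y = x * c" using h_eq xy mult_mem by blast
    then show "dvd_in S x y" using c unfolding dvd_in_def by blast
  next
    assume "dvd_in S x y"
    then show "dvd_in (h ` S) (h x) (h y)" by (auto simp: dvd_in_def h_mult)
  qed
  have prime_image: "prime_in (h ` S) (h p)" if p: "prime_in S p" for p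
  proof -
    have p_props: "p \<in> S" "p \<noteq> 0" "\<not> dvd_in S p 1"
      "\<And>a b. a \<in> S \<Longrightarrow> b \<in> S \<Longrightarrow> dvd_in S p (a * b) \<Longrightarrow> dvd_in S p a \<or> dvd_in S p b"
      using p by (auto simp: prime_in_def)
    have "h p \<noteq> 0" using p_props h_inj by blast
    moreover have "\<not> dvd_in (h ` S) (h p) 1"
      using dvd[OF p_props(1) one_mem] p_props(3) h_one by simp
    moreover have "dvd_in (h ` S) (h p) (h a) \<or> dvd_in (h ` S) (h p) (h b)"
      if "a \<in> S" "b \<in> S" "dvd_in (h ` S) (h p) (h a * h b)" for a b
      using that p_props dvd mult_mem by (metis h_mult)
    ultimately show ?thesis using p_props(1) by (auto simp: prime_in_def)
  qed
  have products: "h a \<in> prime_products (h ` S)" if "a \<in> prime_products S" for a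
    using that
  proof (induction rule: prime_products.induct)
    case (unit u)
    then show ?case using dvd[of u 1] h_one one_mem by (intro prime_products.unit) auto
  next
    case (prime p a)
    have "prime_in (h ` S) (h p)"
      using prime.hyps(1) by (rule prime_image)
    then show ?case using prime.IH by (simp add: h_mult prime_products.prime)
  qed
  show ?thesis
  proof
    fix a assume "a \<in> h ` S" "a \<noteq> 0"
    then show "a \<in> prime_products (h ` S)" using products factorization h_zero by fastforce
  qed
qed

section \<open>Polynomials over a factorial subring\<close>

definition polys_over :: "'a::comm_ring_1 set \<Rightarrow> 'a poly set" where
  "polys_over S = {f. \<forall>n. coeff f n \<in> S}"

lemma polys_overD: "f \<in> polys_over S \<Longrightarrow> coeff f n \<in> S"
  by (simp add: polys_over_def)

context subdomain
begin

lemma const_mem: "c \<in> S \<Longrightarrow> [:c:] \<in> polys_over S"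
  by (auto simp: polys_over_def coeff_pCons zero_mem split: nat.split)

lemma monom_mem: "c \<in> S \<Longrightarrow> monom c n \<in> polys_over S"
  by (auto simp: polys_over_def zero_mem)

text \<open>
  The ambient ring may have zero divisors; degrees add up because leading coefficients lie
  in the domain \<open>S\<close>.
\<close>

lemma degree_mult_polys_over:
  assumes "f \<in> polys_over S" "g \<in> polys_over S" "f \<noteq> 0" "g \<noteq> 0"
  shows "f * g \<noteq> 0" "degree (f * g) = degree f + degree g"
proof -
  have "coeff (f * g) (degree f + degree g) = lead_coeff f * lead_coeff g"
    by (rule coeff_mult_degree_sum)
  also have "\<dots> \<noteq> 0"
    using no_zero_divisors assms by (metis leading_coeff_0_iff polys_overD)
  finally have nz: "coeff (f * g) (degree f + degree g) \<noteq> 0" .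
  then show "f * g \<noteq> 0" by auto
  show "degree (f * g) = degree f + degree g"
    using nz le_degree degree_mult_le antisym by metis
qed

lemma subdomain_polys_over: "subdomain (polys_over S)"
proof
  fix f g :: "'a poly"
  show "f * g \<in> polys_over S" if "f \<in> polys_over S" "g \<in> polys_over S"
    using that by (auto simp: polys_over_def coeff_mult intro!: sum_mem mult_mem)
  show "f = 0 \<or> g = 0" if "f \<in> polys_over S" "g \<in> polys_over S" "f * g = 0"
    using that degree_mult_polys_over by metis
qed (auto simp: polys_over_def zero_mem one_mem coeff_1 intro: add_mem minus_mem)

interpretation poly: subdomain "polys_over S"
  by (rule subdomain_polys_over)

lemma unit_degree:
  assumes "u \<in> polys_over S" "dvd_in (polys_over S) u 1"
  shows "degree u = 0"
proof -
  obtain v where v: "v \<in> polys_over S" "1 = u * v" using assms by (auto simp: dvd_in_def)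
  then have "u \<noteq> 0" "v \<noteq> 0" by auto
  then show ?thesis using degree_mult_polys_over[OF assms(1) v(1)] v(2) by (metis add_is_0 degree_1)
qed

text \<open>
  The quotient is assembled from the coefficientwise quotients.  It is again a polynomial because
  multiplication by \<open>c\<close> is injective on \<open>S\<close>, so the quotients vanish beyond the degree of \<open>f\<close>.
\<close>

lemma const_dvd_iff:
  assumes "c \<in> S" "c \<noteq> 0" "f \<in> polys_over S"
  shows "dvd_in (polys_over S) [:c:] f \<longleftrightarrow> (\<forall>n. dvd_in S c (coeff f n))"
proof
  assume "dvd_in (polys_over S) [:c:] f"
  then show "\<forall>n. dvd_in S c (coeff f n)" by (auto simp: dvd_in_def dest: polys_overD)
next
  assume "\<forall>n. dvd_in S c (coeff f n)"
  then obtain q where q: "\<And>n. q n \<in> S" "\<And>n. coeff f n = c * q n"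
    unfolding dvd_in_def by metis
  define g where "g = (\<Sum>n\<le>degree f. monom (q n) n)"
  have "coeff g n = q n" for n
  proof (cases "n \<le> degree f")
    case True
    then show ?thesis by (simp add: g_def coeff_sum)
  next
    case False
    then have "c * q n = c * 0" using q(2)[of n] coeff_eq_0[of f n] by simp
    then have "q n = 0" using mult_cancel assms q(1) zero_mem by metis
    then show ?thesis using False by (simp add: g_def coeff_sum)
  qed
  then have "g \<in> polys_over S" "f = [:c:] * g" using q by (auto simp: polys_over_def poly_eq_iff)
  then show "dvd_in (polys_over S) [:c:] f" by (auto simp: dvd_in_def)
qed

lemma drop_lead_term:
  assumes "f \<in> polys_over S" "f \<noteq> 0"
  defines "f' \<equiv> f - monom (lead_coeff f) (degree f)"
  shows "f' \<in> polys_over S" "f' = 0 \<or> degree f' < degree f"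
proof -
  show "f' \<in> polys_over S" 
    unfolding f'_def using assms(1) by (intro poly.diff_mem monom_mem) (auto dest: polys_overD)
  show "f' = 0 \<or> degree f' < degree f"
    unfolding f'_def by (intro eq_zero_or_degree_less) (auto intro: degree_diff_le degree_monom_le)
qed

text \<open>
  If \<open>p\<close> divides \<open>f * g\<close> then it divides the product of the leading coefficients, hence one of
  them, say that of \<open>f\<close>.  Dropping that leading term leaves a shorter \<open>f'\<close> with
  \<open>p\<close> still dividing \<open>f' * g\<close>.  The induction is on the number of coefficients, which,
  unlike the degree, also drops when a constant becomes \<open>0\<close>.
\<close>

lemma prime_in_const:
  assumes p: "prime_in S p"
  shows "prime_in (polys_over S) [:p:]"
proof -
  let ?P = "polys_over S"
  have pS: "p \<in> S" "p \<noteq> 0" "\<not> dvd_in S p 1" using p by (auto simp: prime_in_def)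
  have key: "dvd_in ?P [:p:] f \<or> dvd_in ?P [:p:] g"
    if "f \<in> ?P" "g \<in> ?P" "dvd_in ?P [:p:] (f * g)" for f g
    using that
  proof (induction "length (coeffs f) + length (coeffs g)" arbitrary: f g rule: less_induct)
    case less
    have zero: "dvd_in ?P [:p:] 0" using poly.zero_mem by (auto simp: dvd_in_def intro!: bexI[of _ 0])
    have smaller: "length (coeffs (f - monom (lead_coeff f) (degree f))) < length (coeffs f)"
      if "f \<in> ?P" "f \<noteq> 0" for f
      using drop_lead_term[OF that] that
      by (cases "f - monom (lead_coeff f) (degree f) = 0") (auto simp: length_coeffs)
    \<comment> \<open>By symmetry it is enough to treat the case that \<open>p\<close> divides the first leading coefficient.\<close>
    have step: "dvd_in ?P [:p:] f \<or> dvd_in ?P [:p:] g"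
      if *: "f \<in> ?P" "g \<in> ?P" "dvd_in ?P [:p:] (f * g)" "f \<noteq> 0" "dvd_in S p (lead_coeff f)"
        and IH: "\<And>f'. f' \<in> ?P \<Longrightarrow> length (coeffs f') < length (coeffs f) \<Longrightarrow>
                   dvd_in ?P [:p:] (f' * g) \<Longrightarrow> dvd_in ?P [:p:] f' \<or> dvd_in ?P [:p:] g" for f g
    proof -
      define m where "m = monom (lead_coeff f) (degree f)"
      have mP: "m \<in> ?P" unfolding m_def using * by (intro monom_mem) (auto dest: polys_overD)
      have "dvd_in S p 0" using zero_mem by (auto simp: dvd_in_def intro!: bexI[of _ 0])
      then have m: "dvd_in ?P [:p:] m" using * pS mP by (subst const_dvd_iff) (auto simp: m_def)
      have "dvd_in ?P [:p:] ((f - m) * g)"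
        using poly.dvd_in_diff[OF *(3) poly.dvd_in_mult[OF m *(2)]] by (simp add: left_diff_distrib)
      then have "dvd_in ?P [:p:] (f - m) \<or> dvd_in ?P [:p:] g"
        using IH drop_lead_term smaller * unfolding m_def by metis
      then show ?thesis using poly.dvd_in_add[OF _ m, of "f - m"] by auto
    qed
    show ?case
    proof (cases "f = 0 \<or> g = 0")
      case True
      then show ?thesis using zero by auto
    next
      case False
      have "dvd_in S p (coeff (f * g) (degree f + degree g))"
        using less.prems const_dvd_iff pS poly.mult_mem by blast
      then have "dvd_in S p (lead_coeff f * lead_coeff g)" by (simp add: coeff_mult_degree_sum)
      then consider "dvd_in S p (lead_coeff f)" | "dvd_in S p (lead_coeff g)"
        using p less.prems polys_overD unfolding prime_in_def by blast
      then show ?thesis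
      proof cases
        case 1
        show ?thesis by (rule step[OF less.prems]) (use False 1 less in auto)
      next
        case 2
        have "dvd_in ?P [:p:] g \<or> dvd_in ?P [:p:] f"
        proof (rule step[OF less.prems(2,1)])
          show "dvd_in ?P [:p:] (g * f)" using less.prems(3) by (simp add: mult.commute)
          show "dvd_in ?P [:p:] g' \<or> dvd_in ?P [:p:] f"
            if "g' \<in> ?P" "length (coeffs g') < length (coeffs g)" "dvd_in ?P [:p:] (g' * f)" for g'
            using less.hyps[of f g'] that less.prems by (auto simp: mult.commute)
        qed (use False 2 in auto)
        then show ?thesis by auto
      qed
    qed
  qed
  have "\<not> dvd_in ?P [:p:] 1"
    using const_dvd_iff[OF pS(1,2) poly.one_mem] pS(3) by (auto dest!: spec[of _ 0])
  then show ?thesis using key pS const_mem by (auto simp: prime_in_def)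
qed

text \<open>
  Leading coefficients cannot be inverted in \<open>S\<close>, so division with remainder needs a constant
  multiple of the dividend.
\<close>

lemma pseudo_division:
  assumes "d \<in> polys_over S" "d \<noteq> 0" "f \<in> polys_over S"
  shows "\<exists>c\<in>S. \<exists>q\<in>polys_over S. c \<noteq> 0 \<and>
           ([:c:] * f - d * q = 0 \<or> degree ([:c:] * f - d * q) < degree d)"
  using assms(3)
proof (induction "length (coeffs f)" arbitrary: f rule: less_induct)
  case less
  let ?a = "lead_coeff d" and ?b = "lead_coeff f"
  have a: "?a \<in> S" "?a \<noteq> 0" using assms polys_overD by auto
  have b: "?b \<in> S" using less.prems polys_overD by auto
  show ?case
  proof (cases "f = 0 \<or> degree f < degree d")
    case True
    then show ?thesis
      using one_mem poly.zero_mem by (intro bexI[of _ 1] bexI[of _ 0]) auto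
  next
    case False
    define t where "t = monom ?b (degree f - degree d)"
    define f' where "f' = [:?a:] * f - d * t"
    have t: "t \<in> polys_over S" unfolding t_def by (rule monom_mem) (rule b)
    have f': "f' \<in> polys_over S"
      unfolding f'_def using less.prems assms t a by (intro poly.diff_mem poly.mult_mem const_mem)
    have "f' = 0 \<or> degree f' < degree f"
    proof (rule eq_zero_or_degree_less)
      have "degree (d * t) \<le> degree d + (degree f - degree d)"
        using degree_mult_le[of d t] degree_monom_le[of ?b "degree f - degree d"]
        unfolding t_def by linarith
      then show "degree f' \<le> degree f"
        unfolding f'_def using False by (intro degree_diff_le) (auto intro: degree_smult_le)
      have "coeff (d * t) (degree f) = ?a * ?b"
        unfolding t_def using False by (simp add: mult.commute[of d] coeff_monom_mult)
      then show "coeff f' (degree f) = 0" by (simp add: f'_def)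
    qed
    then have "length (coeffs f') < length (coeffs f)"
      using False by (cases "f' = 0") (auto simp: length_coeffs)
    from less.hyps[OF this f'] obtain c q where cq: "c \<in> S" "q \<in> polys_over S" "c \<noteq> 0"
      "[:c:] * f' - d * q = 0 \<or> degree ([:c:] * f' - d * q) < degree d" by blast
    have "[:c * ?a:] * f - d * ([:c:] * t + q) = [:c:] * f' - d * q"
      by (simp add: f'_def algebra_simps smult_diff_right)
    moreover have "c * ?a \<in> S" "c * ?a \<noteq> 0" "[:c:] * t + q \<in> polys_over S"
      using cq a t mult_mem no_zero_divisors const_mem poly.add_mem poly.mult_mem by blast+
    ultimately show ?thesis using cq(4) by metis
  qed
qed

end

context factorial_subring
begin

abbreviation P where "P \<equiv> polys_over S"

interpretation poly: subdomain P
  by (rule subdomain_polys_over)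

text \<open>
  Each prime factor of \<open>c\<close> stays prime among the polynomials and does not divide the primitive \<open>f\<close>;
  so it divides \<open>k\<close> and can be cancelled.  This removes the constants that pseudo-division leaves.
\<close>

lemma dvd_cancel_const:
  assumes "c \<in> S" "c \<noteq> 0" and "f \<in> P" "k \<in> P" "h \<in> P"
    and prim: "\<And>p. prime_in S p \<Longrightarrow> \<not> dvd_in P [:p:] f"
    and eq: "f * k = [:c:] * h"
  shows "dvd_in P f h"
proof -
  have "c \<in> prime_products S" using assms factorization by blast
  then show ?thesis using assms(4) eq
  proof (induction arbitrary: k rule: prime_products.induct)
    case (unit u)
    then obtain v where v: "v \<in> S" "1 = u * v" by (auto simp: dvd_in_def)
    have "h = [:v:] * ([:u:] * h)" by (simp add: mult.commute[of v] v(2)[symmetric])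
    also have "\<dots> = f * ([:v:] * k)" unfolding unit.prems(2)[symmetric] by (rule mult.left_commute)
    finally show ?case using v unit.prems const_mem poly.mult_mem unfolding dvd_in_def by blast
  next
    case (prime p c)
    have p: "prime_in P [:p:]" "p \<in> S" "p \<noteq> 0"
      using prime prime_in_const by (auto simp: prime_in_def)
    have c: "c \<in> S" using prime prime_products_nonzero by blast
    have eq: "f * k = [:p:] * ([:c:] * h)" using prime.prems(2) by (simp add: mult.commute[of p])
    have "[:c:] * h \<in> P" using c assms const_mem poly.mult_mem by blast
    then have "dvd_in P [:p:] (f * k)" using eq unfolding dvd_in_def by blast
    then have "dvd_in P [:p:] k"
      using p prim prime.hyps prime.prems(1) assms(3) unfolding prime_in_def by blast
    then obtain k' where k': "k' \<in> P" "k = [:p:] * k'" by (auto simp: dvd_in_def)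
    have "[:p:] * (f * k') = [:p:] * ([:c:] * h)" using eq k' by (simp add: mult.left_commute)
    then have "f * k' = [:c:] * h"
      using poly.mult_cancel[of "[:p:]"] p const_mem k' assms c poly.mult_mem by (metis pCons_eq_0_iff)
    then show ?case using prime.IH k' by blast
  qed
qed

text \<open>
  Each prime factor of \<open>c\<close> divides \<open>d\<close> or \<open>e\<close>.  Those that are taken out of \<open>d\<close> make up \<open>a\<close>, those
  taken out of \<open>e\<close> are dropped.
\<close>

lemma primitive_part_dvd:
  assumes "c \<in> S" "c \<noteq> 0" and "f \<in> P" "d \<in> P" "e \<in> P"
    and eq: "[:c:] * f = d * e"
  shows "\<exists>a\<in>S. \<exists>d'\<in>P. a \<noteq> 0 \<and> d = [:a:] * d' \<and> dvd_in P d' f"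
proof -
  have "c \<in> prime_products S" using assms factorization by blast
  then show ?thesis using assms(4,5) eq
  proof (induction arbitrary: d e rule: prime_products.induct)
    case (unit u)
    then obtain v where v: "v \<in> S" "1 = u * v" by (auto simp: dvd_in_def)
    have "f = [:v:] * ([:u:] * f)" by (simp add: mult.commute[of v] v(2)[symmetric])
    also have "\<dots> = d * ([:v:] * e)" unfolding unit.prems(3) by (rule mult.left_commute)
    finally have "dvd_in P d f"
      using v unit.prems const_mem poly.mult_mem unfolding dvd_in_def by blast
    then show ?case using one_mem unit.prems(1) by (intro bexI[of _ 1] bexI[of _ d]) auto
  next
    case (prime p c)
    have p: "prime_in P [:p:]" "p \<in> S" "p \<noteq> 0"
      using prime prime_in_const by (auto simp: prime_in_def)
    have c: "c \<in> S" using prime prime_products_nonzero by blast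
    have eq: "d * e = [:p:] * ([:c:] * f)" using prime.prems(3)[symmetric] by (simp add: mult.commute[of p])
    have cf: "[:c:] * f \<in> P" using c assms const_mem poly.mult_mem by blast
    then have "dvd_in P [:p:] (d * e)" using eq unfolding dvd_in_def by blast
    then consider d' where "d' \<in> P" "d = [:p:] * d'" | e' where "e' \<in> P" "e = [:p:] * e'"
      using p prime.prems unfolding prime_in_def dvd_in_def by metis
    then show ?case
    proof cases
      case 1
      have "[:p:] * ([:c:] * f) = [:p:] * (d' * e)" using eq 1 by (simp add: mult.left_commute)
      then have "[:c:] * f = d' * e"
        using poly.mult_cancel[of "[:p:]"] p const_mem 1 prime.prems cf poly.mult_mem
        by (metis pCons_eq_0_iff)
      then obtain a d'' where a: "a \<in> S" "d'' \<in> P" "a \<noteq> 0" "d' = [:a:] * d''" "dvd_in P d'' f"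
        using prime.IH 1 prime.prems by blast
      then have "d = [:p * a:] * d''" using 1 by (simp add: mult.commute[of p])
      moreover have "p * a \<in> S" "p * a \<noteq> 0" using p a mult_mem no_zero_divisors by blast+
      ultimately show ?thesis using a by blast
    next
      case 2
      have "[:p:] * ([:c:] * f) = [:p:] * (d * e')" using eq 2 by (simp add: mult.left_commute)
      then have "[:c:] * f = d * e'"
        using poly.mult_cancel[of "[:p:]"] p const_mem 2 prime.prems cf poly.mult_mem
        by (metis pCons_eq_0_iff)
      then show ?thesis using prime.IH 2 prime.prems by blast
    qed
  qed
qed

text \<open>
  This is the argument for principal ideal domains, up to constants.  If \<open>f\<close> divides \<open>g * h\<close> but not
  \<open>g\<close>, then a nonzero element \<open>d\<close> of minimal degree in the ideal \<open>I\<close> generated by \<open>f\<close> and \<open>g\<close> divides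
  constant multiples of both.  So \<open>d\<close> is a constant times a divisor \<open>d'\<close> of the irreducible \<open>f\<close>.
  If the cofactor is a unit then \<open>f\<close> divides \<open>g\<close>, a contradiction; so \<open>d'\<close> is a unit, \<open>d\<close> is
  constant up to a unit, and multiplying \<open>d = u * g + v * f\<close> by \<open>h\<close> shows that \<open>f\<close> divides \<open>h\<close>.
\<close>

lemma irreducible_imp_prime:
  assumes f: "f \<in> P" "degree f > 0"
    and irr: "\<And>a b. a \<in> P \<Longrightarrow> b \<in> P \<Longrightarrow> f = a * b \<Longrightarrow> dvd_in P a 1 \<or> dvd_in P b 1"
  shows "prime_in P f"
proof -
  have f0: "f \<noteq> 0" using f by auto
  have prim: "\<not> dvd_in P [:p:] f" if "prime_in S p" for p
  proof
    assume "dvd_in P [:p:] f"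
    then obtain g where g: "g \<in> P" "f = [:p:] * g" by (auto simp: dvd_in_def)
    have p: "prime_in P [:p:]" "[:p:] \<in> P" "[:p:] \<noteq> 0"
      using prime_in_const[OF that] by (auto simp: prime_in_def)
    then have "dvd_in P g 1" using irr[of "[:p:]" g] g by (auto simp: prime_in_def)
    then have "degree g = 0" using unit_degree g by blast
    moreover have "g \<noteq> 0" using g f0 by auto
    ultimately show False using degree_mult_polys_over(2)[OF p(2) g(1)] p(3) g(2) f by simp
  qed
  have "dvd_in P f h" if gh: "g \<in> P" "h \<in> P" "dvd_in P f (g * h)" and ng: "\<not> dvd_in P f g" for g h
  proof -
    obtain k where k: "k \<in> P" "g * h = f * k" using gh by (auto simp: dvd_in_def)
    define I where "I = {u * g + v * f | u v. u \<in> P \<and> v \<in> P}"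
    have IP: "I \<subseteq> P"
      using gh f by (auto simp: I_def intro!: poly.add_mem poly.mult_mem)
    have fI: "f \<in> I" and gI: "g \<in> I"
      using poly.zero_mem poly.one_mem unfolding I_def by force+
    have I_diff: "[:c:] * y - d * q \<in> I" if "y \<in> I" "d \<in> I" "c \<in> S" "q \<in> P" for y d c q
    proof -
      obtain u v where uv: "y = u * g + v * f" "u \<in> P" "v \<in> P"
        using \<open>y \<in> I\<close> by (auto simp: I_def)
      obtain u' v' where uv': "d = u' * g + v' * f" "u' \<in> P" "v' \<in> P"
        using \<open>d \<in> I\<close> by (auto simp: I_def)
      have "x * y - d * q = (x * u - u' * q) * g + (x * v - v' * q) * f" for x
        unfolding uv(1) uv'(1) by (simp add: algebra_simps)
      moreover have "[:c:] * u - u' * q \<in> P" "[:c:] * v - v' * q \<in> P"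
        using uv uv' that by (auto intro!: const_mem poly.mult_mem poly.diff_mem simp del: mult_pCons_left)
      ultimately show ?thesis unfolding I_def by blast
    qed
    obtain d where d: "d \<in> I" "d \<noteq> 0" and d_min: "\<And>y. y \<in> I \<Longrightarrow> y \<noteq> 0 \<Longrightarrow> degree d \<le> degree y"
      using ex_has_least_nat[of "\<lambda>y. y \<in> I \<and> y \<noteq> 0" f degree] fI f0 by blast
    have divides: "\<exists>c\<in>S. \<exists>q\<in>P. c \<noteq> 0 \<and> [:c:] * y = d * q" if y: "y \<in> I" for y
    proof -
      obtain c q where cq: "c \<in> S" "q \<in> P" "c \<noteq> 0"
        "[:c:] * y - d * q = 0 \<or> degree ([:c:] * y - d * q) < degree d"
        using pseudo_division[of d y] d y IP by blast
      then have "[:c:] * y - d * q = 0" using I_diff[OF y d(1)] d_min by (meson not_le)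
      then show ?thesis using cq by auto
    qed
    have dP: "d \<in> P" using d IP by blast
    obtain c q where cq: "c \<in> S" "q \<in> P" "c \<noteq> 0" "[:c:] * f = d * q"
      using divides[OF fI] by blast
    obtain a d' where a: "a \<in> S" "d' \<in> P" "a \<noteq> 0" "d = [:a:] * d'" "dvd_in P d' f"
      using primitive_part_dvd[OF cq(1,3) f(1) dP cq(2,4)] by blast
    then obtain e where e: "e \<in> P" "f = d' * e" by (auto simp: dvd_in_def)
    consider e' where "e' \<in> P" "1 = e * e'" | w where "w \<in> P" "1 = d' * w"
      using irr[OF a(2) e] unfolding dvd_in_def by blast
    then show ?thesis
    proof cases
      case 1
      obtain c q where cq: "c \<in> S" "q \<in> P" "c \<noteq> 0" "[:c:] * g = d * q"
        using divides[OF gI] by blast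
      have "d' = d' * (e * e')" using 1(2) by (metis mult_1_right)
      then have "d' = f * e'" using e(2) by (metis mult.assoc)
      then have "f * (e' * [:a:] * q) = [:c:] * g" unfolding cq(4) a(4) by (simp only: mult_ac)
      moreover have "e' * [:a:] * q \<in> P"
        by (intro const_mem poly.mult_mem 1 a cq)
      ultimately have "dvd_in P f g" using dvd_cancel_const[OF cq(1,3) f(1) _ gh(1)] prim by blast
      then show ?thesis using ng by blast
    next
      case 2
      obtain u v where uv: "d = u * g + v * f" "u \<in> P" "v \<in> P"
        using d by (auto simp: I_def)
      have "[:a:] * h = [:a:] * (d' * w) * h" using 2(2) by (metis mult_1_right)
      also have "\<dots> = w * (d * h)" unfolding a(4) by (simp only: mult_ac)
      also have "\<dots> = w * (u * (g * h) + v * f * h)" unfolding uv(1) by (simp add: algebra_simps)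
      also have "\<dots> = f * (w * (u * k + v * h))" unfolding k(2) by (simp add: algebra_simps)
      finally have "f * (w * (u * k + v * h)) = [:a:] * h" ..
      moreover have "w * (u * k + v * h) \<in> P"
        by (intro poly.mult_mem poly.add_mem 2 uv k gh)
      ultimately show ?thesis using dvd_cancel_const[OF a(1,3) f(1) _ gh(2)] prim by blast
    qed
  qed
  moreover have "\<not> dvd_in P f 1" using unit_degree f by auto
  ultimately show ?thesis using f f0 unfolding prime_in_def by blast
qed

text \<open>
  Every constant that divides \<open>f\<close> divides the leading coefficient, so it suffices to consider any
  product \<open>l\<close> of primes that is a multiple of all constant divisors of \<open>f\<close>.  A prime factor of \<open>l\<close> is
  either taken out of \<open>f\<close> or, if it does not divide \<open>f\<close>, dropped from \<open>l\<close>.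
\<close>

lemma primitive_decomposition:
  assumes "f \<in> P" "f \<noteq> 0"
  shows "\<exists>c\<in>S. \<exists>g\<in>P. f = [:c:] * g \<and> (\<forall>a\<in>S. dvd_in P [:a:] g \<longrightarrow> dvd_in S a 1)"
proof -
  have "\<exists>c\<in>S. \<exists>g\<in>P. f = [:c:] * g \<and> (\<forall>a\<in>S. dvd_in P [:a:] g \<longrightarrow> dvd_in S a 1)"
    if "l \<in> prime_products S" and "\<And>a. a \<in> S \<Longrightarrow> dvd_in P [:a:] f \<Longrightarrow> dvd_in S a l" for l
    using that assms
  proof (induction arbitrary: f rule: prime_products.induct)
    case (unit u)
    have "dvd_in S a 1" if a: "a \<in> S" "dvd_in P [:a:] f" for a
    proof -
      obtain b where b: "b \<in> S" "u = a * b" using unit.prems(1)[OF a] by (auto simp: dvd_in_def)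
      obtain v where v: "v \<in> S" "1 = u * v" using unit.hyps by (auto simp: dvd_in_def)
      have "1 = a * (b * v)" using b(2) v(2) by (simp add: mult.assoc)
      then show ?thesis using b v mult_mem unfolding dvd_in_def by blast
    qed
    then show ?case using unit.prems one_mem by (intro bexI[of _ 1] bexI[of _ f]) auto
  next
    case (prime p l)
    have p: "prime_in P [:p:]" "[:p:] \<in> P" "p \<in> S" "p \<noteq> 0"
      using prime.hyps prime_in_const by (auto simp: prime_in_def)
    have l: "l \<in> S" using prime.hyps prime_products_nonzero by blast
    show ?case
    proof (cases "dvd_in P [:p:] f")
      case True
      then obtain f' where f': "f' \<in> P" "f = [:p:] * f'" by (auto simp: dvd_in_def)
      have "dvd_in S a l" if a: "a \<in> S" "dvd_in P [:a:] f'" for a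
      proof -
        obtain g where g: "g \<in> P" "f' = [:a:] * g" using a by (auto simp: dvd_in_def)
        have "f = [:p * a:] * g" using f' g by (simp add: mult.commute[of p])
        then have "dvd_in S (p * a) (p * l)"
          using prime.prems(1)[of "p * a"] p a g mult_mem unfolding dvd_in_def by blast
        then obtain s where s: "s \<in> S" "p * l = p * (a * s)" by (auto simp: dvd_in_def mult.assoc)
        then have "l = a * s" using mult_cancel[OF p(3) l _ p(4)] a mult_mem by blast
        then show ?thesis using s unfolding dvd_in_def by blast
      qed
      moreover have "f' \<noteq> 0" using f' prime.prems(3) by auto
      ultimately obtain c g where "c \<in> S" "g \<in> P" "f' = [:c:] * g"
        "\<forall>a\<in>S. dvd_in P [:a:] g \<longrightarrow> dvd_in S a 1"
        using prime.IH[OF _ f'(1)] by blast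
      moreover from this have "f = [:p * c:] * g" using f' by (simp add: mult.commute[of p])
      ultimately show ?thesis using p mult_mem by blast
    next
      case False
      have "dvd_in S a l" if a: "a \<in> S" "dvd_in P [:a:] f" for a
      proof -
        obtain g where g: "g \<in> P" "f = [:a:] * g" using a by (auto simp: dvd_in_def)
        obtain s where s: "s \<in> S" "p * l = a * s" using prime.prems(1)[OF a] by (auto simp: dvd_in_def)
        have "\<not> dvd_in S p a"
        proof
          assume "dvd_in S p a"
          then obtain t where t: "t \<in> S" "a = p * t" by (auto simp: dvd_in_def)
          have "f = [:p:] * ([:t:] * g)" using g t by (simp add: mult.commute[of p])
          then show False using False t g const_mem poly.mult_mem unfolding dvd_in_def by blast
        qed
        moreover have "dvd_in S p (a * s)" using s l unfolding dvd_in_def by metis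
        ultimately have "dvd_in S p s" using prime.hyps(1) a s unfolding prime_in_def by blast
        then obtain t where t: "t \<in> S" "s = p * t" by (auto simp: dvd_in_def)
        have "p * l = p * (a * t)" using s t by (simp add: mult.left_commute)
        then have "l = a * t" using mult_cancel[OF p(3) l _ p(4)] a t mult_mem by blast
        then show ?thesis using t unfolding dvd_in_def by blast
      qed
      then show ?thesis using prime.IH prime.prems by blast
    qed
  qed
  moreover have "lead_coeff f \<in> prime_products S"
    using factorization assms polys_overD by (metis leading_coeff_0_iff)
  moreover have "dvd_in S a (lead_coeff f)" if "a \<in> S" "dvd_in P [:a:] f" for a
    using that const_dvd_iff[of a f] assms by (cases "a = 0") (auto simp: dvd_in_def)
  ultimately show ?thesis by blast
qed

lemma const_prime_products: "c \<in> prime_products S \<Longrightarrow> [:c:] \<in> prime_products P"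
proof (induction rule: prime_products.induct)
  case (unit u)
  then obtain v where "v \<in> S" "1 = u * v" by (auto simp: dvd_in_def)
  then have "[:v:] \<in> P" "1 = [:u:] * [:v:]" using const_mem by (auto simp: one_pCons mult.commute)
  then have "dvd_in P [:u:] 1" unfolding dvd_in_def by blast
  then show ?case using unit const_mem by (intro prime_products.unit)
next
  case (prime p a)
  then have "[:p:] * [:a:] \<in> prime_products P" using prime_in_const prime_products.prime by blast
  then show ?case by (simp add: mult.commute[of p])
qed

text \<open>
  Gauss's lemma.  A primitive polynomial has no nonunit constant factor, so a proper factorization
  splits it into factors of strictly smaller degree; without one it is irreducible, hence prime.
\<close>

theorem factorial_subring_polys_over: "factorial_subring P"
proof -
  have "f \<in> prime_products P" if "f \<in> P" "f \<noteq> 0" for f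
    using that
  proof (induction "degree f" arbitrary: f rule: less_induct)
    case less
    obtain c g where cg: "c \<in> S" "g \<in> P" "f = [:c:] * g"
      and prim: "\<And>a. a \<in> S \<Longrightarrow> dvd_in P [:a:] g \<Longrightarrow> dvd_in S a 1"
      using primitive_decomposition less.prems by blast
    have "c \<noteq> 0" "g \<noteq> 0" using cg less.prems by auto
    then have deg: "degree f = degree g"
      using degree_mult_polys_over(2)[of "[:c:]" g] cg const_mem by simp
    have c: "[:c:] \<in> prime_products P"
      using const_prime_products factorization cg \<open>c \<noteq> 0\<close> by blast
    have const_unit: "dvd_in P a 1" if a: "a \<in> P" "b \<in> P" "g = a * b" "degree a = 0" for a b
    proof -
      obtain a0 where a0: "a = [:a0:]" using a degree_eq_zeroE by blast
      then have "a0 \<in> S" using polys_overD[OF a(1), of 0] by simp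
      then obtain v where "v \<in> S" "1 = a0 * v"
        using prim a a0 unfolding dvd_in_def by blast
      then have "[:v:] \<in> P" "1 = a * [:v:]" using a0 const_mem by (auto simp: one_pCons mult.commute)
      then show ?thesis unfolding dvd_in_def by blast
    qed
    have "g \<in> prime_products P"
    proof (cases "degree g = 0")
      case True
      then show ?thesis
        using const_unit[of g 1] cg poly.one_mem by (intro prime_products.unit) auto
    next
      case False
      show ?thesis
      proof (cases "\<exists>a\<in>P. \<exists>b\<in>P. g = a * b \<and> degree a \<noteq> 0 \<and> degree b \<noteq> 0")
        case True
        then obtain a b where ab: "a \<in> P" "b \<in> P" "g = a * b" "degree a \<noteq> 0" "degree b \<noteq> 0"
          by blast
        then have "a \<noteq> 0" "b \<noteq> 0" by auto
        then have "degree g = degree a + degree b"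
          using degree_mult_polys_over(2) ab by blast
        then have "a \<in> prime_products P" "b \<in> prime_products P"
          using less.hyps deg ab \<open>a \<noteq> 0\<close> \<open>b \<noteq> 0\<close> by auto
        then show ?thesis using ab(3) poly.mult_prime_products by blast
      next
        case False
        then have "prime_in P g"
          using \<open>degree g \<noteq> 0\<close> cg const_unit
          by (intro irreducible_imp_prime) (auto, metis mult.commute)
        then show ?thesis by (rule poly.prime_in_prime_products)
      qed
    qed
    then show ?case using c cg poly.mult_prime_products by blast
  qed
  then show ?thesis
    by (intro factorial_subring.intro subdomain_polys_over factorial_subring_axioms.intro)
qed

end

section \<open>Multivariate polynomials over a field\<close>

definition polys_in :: "'n set \<Rightarrow> ('n, 'k::field_char_0) mpoly set" where
  "polys_in V = {f. \<forall>J\<in>Poly_Mapping.keys f. Poly_Mapping.keys J \<subseteq> V}"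

abbreviation var :: "'n \<Rightarrow> ('n, 'k::field_char_0) mpoly" where
  "var i \<equiv> Poly_Mapping.single (Poly_Mapping.single i 1) 1"

lemma sum_monomials:
  "(\<Sum>J\<in>Poly_Mapping.keys f. Poly_Mapping.single J (Poly_Mapping.lookup f J)) = f"
  by (rule poly_mapping_eqI) (simp add: lookup_sum lookup_single when_def in_keys_iff)

lemma polys_in_add: "f \<in> polys_in V \<Longrightarrow> g \<in> polys_in V \<Longrightarrow> f + g \<in> polys_in V"
  unfolding polys_in_def using Poly_Mapping.keys_add[of f g] by blast

lemma polys_in_mult:
  assumes "f \<in> polys_in V" "g \<in> polys_in V" shows "f * g \<in> polys_in V"
proof -
  have "Poly_Mapping.keys J \<subseteq> V" if J: "J \<in> Poly_Mapping.keys (f * g)" for J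
  proof -
    obtain a b where "J = a + b" "a \<in> Poly_Mapping.keys f" "b \<in> Poly_Mapping.keys g"
      using J keys_mult[of f g] by blast
    then show ?thesis using assms Poly_Mapping.keys_add[of a b] unfolding polys_in_def by blast
  qed
  then show ?thesis by (simp add: polys_in_def)
qed

lemma polys_in_lookup_eq_0:
  assumes "f \<in> polys_in V" "i \<notin> V" "Poly_Mapping.lookup J i \<noteq> 0"
  shows "Poly_Mapping.lookup f J = 0"
proof (rule ccontr)
  assume "Poly_Mapping.lookup f J \<noteq> 0"
  then have "Poly_Mapping.keys J \<subseteq> V" using assms(1) by (simp add: polys_in_def in_keys_iff)
  moreover have "i \<in> Poly_Mapping.keys J" using assms(3) by (simp add: in_keys_iff)
  ultimately show False using assms(2) by blast
qed

lemma polys_in_mono: "V \<subseteq> W \<Longrightarrow> polys_in V \<subseteq> polys_in W"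
  by (auto simp: polys_in_def)

lemma polys_in_sum: "(\<And>x. x \<in> A \<Longrightarrow> f x \<in> polys_in V) \<Longrightarrow> sum f A \<in> polys_in V"
proof (induction A rule: infinite_finite_induct)
  case (insert x A)
  then have "f x + sum f A \<in> polys_in V" by (intro polys_in_add) auto
  then show ?case using insert.hyps by simp
qed (simp_all add: polys_in_def)

lemma var_power: "var i ^ k = Poly_Mapping.single (Poly_Mapping.single i k) 1"
  by (induction k) (simp_all add: mult_single single_add[symmetric])

lemma lookup_mult_single:
  fixes f :: "('n, 'k::field_char_0) mpoly"
  shows "Poly_Mapping.lookup (f * Poly_Mapping.single K 1) (J + K) = Poly_Mapping.lookup f J"
  by (induction f rule: lpdo_induct)
    (simp_all add: mult_single lookup_single when_def distrib_right lookup_add)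

text \<open>
  The coefficients of \<open>p\<close> do not involve the variable \<open>i\<close>, so no monomials collide when \<open>p\<close> is
  evaluated there: the exponent of \<open>i\<close> tells which coefficient a monomial comes from.
\<close>

lemma lookup_poly_var:
  fixes p :: "('n, 'k::field_char_0) mpoly poly"
  assumes "p \<in> polys_over (polys_in V)" "i \<notin> V" "Poly_Mapping.lookup J i = 0"
  shows "Poly_Mapping.lookup (poly p (var i)) (J + Poly_Mapping.single i m) =
           Poly_Mapping.lookup (coeff p m) J"
proof -
  let ?e = "\<lambda>k. Poly_Mapping.single i k :: 'n \<Rightarrow>\<^sub>0 nat"
  have summand: "Poly_Mapping.lookup (coeff p k * var i ^ k) (J + ?e m) =
      (if k = m then Poly_Mapping.lookup (coeff p m) J else 0)" for k
  proof (cases "k = m")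
    case True
    then show ?thesis by (simp only: var_power lookup_mult_single) simp
  next
    case False
    have "J + ?e m \<notin> Poly_Mapping.keys (coeff p k * Poly_Mapping.single (?e k) 1)"
    proof
      assume "J + ?e m \<in> Poly_Mapping.keys (coeff p k * Poly_Mapping.single (?e k) 1)"
      then obtain I where I: "I \<in> Poly_Mapping.keys (coeff p k)" "J + ?e m = I + ?e k"
        using keys_mult[of "coeff p k" "Poly_Mapping.single (?e k) 1"] by auto
      then have "Poly_Mapping.lookup I i = 0"
        using polys_in_lookup_eq_0[OF polys_overD[OF assms(1)] assms(2)] by (auto simp: in_keys_iff)
      then show False
        using arg_cong[OF I(2), of "\<lambda>K. Poly_Mapping.lookup K i"] assms(3) False
        by (simp add: lookup_add)
    qed
    then show ?thesis using False by (simp only: var_power in_keys_iff) simp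
  qed
  have "m \<le> degree p \<or> coeff p m = 0" using coeff_eq_0 not_le by blast
  then show ?thesis
    by (auto simp: poly_altdef lookup_sum summand simp del: One_nat_def)
qed

lemma poly_var_eq_0D:
  fixes p :: "('n, 'k::field_char_0) mpoly poly"
  assumes "p \<in> polys_over (polys_in V)" "i \<notin> V" "poly p (var i) = 0"
  shows "p = 0"
proof (intro poly_eqI poly_mapping_eqI)
  fix m J
  show "Poly_Mapping.lookup (coeff p m) J = Poly_Mapping.lookup (coeff 0 m) J"
  proof (cases "Poly_Mapping.lookup J i = 0")
    case True
    then show ?thesis using lookup_poly_var[OF assms(1,2) True, of m] assms(3) by simp
  next
    case False
    then show ?thesis using polys_in_lookup_eq_0[OF polys_overD[OF assms(1)] assms(2)] by simp
  qed
qed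

lemma polys_in_empty: "polys_in {} = range (Poly_Mapping.single 0)"
proof (intro equalityI subsetI)
  fix f :: "('n, 'k::field_char_0) mpoly"
  assume "f \<in> polys_in {}"
  then have "Poly_Mapping.keys f \<subseteq> {0}" by (auto simp: polys_in_def)
  then have "f = Poly_Mapping.single 0 (Poly_Mapping.lookup f 0)"
    by (intro poly_mapping_eqI) (auto simp: lookup_single when_def in_keys_iff)
  then show "f \<in> range (Poly_Mapping.single 0)" by blast
qed (auto simp: polys_in_def split: if_splits)

lemma factorial_subring_constants:
  "factorial_subring (polys_in {} :: ('n, 'k::field_char_0) mpoly set)"
proof -
  let ?S = "range (Poly_Mapping.single 0) :: ('n, 'k) mpoly set"
  interpret subdomain ?S
  proof
    show "1 \<in> ?S" "0 \<in> ?S" by (rule range_eqI[of _ _ 1], simp, rule range_eqI[of _ _ 0], simp)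
    fix f g assume "f \<in> ?S" "g \<in> ?S"
    then obtain a b where ab: "f = Poly_Mapping.single 0 a" "g = Poly_Mapping.single 0 b" by blast
    show "f + g \<in> ?S" "f * g \<in> ?S" by (simp_all add: ab mult_single single_add[symmetric])
    show "f = 0 \<or> g = 0" if "f * g = 0"
      using arg_cong[OF that, of "\<lambda>h. Poly_Mapping.lookup h 0"] by (auto simp: ab mult_single)
  next
    fix f assume "f \<in> ?S"
    then show "- f \<in> ?S" by (auto simp: single_uminus[symmetric])
  qed
  have "f \<in> prime_products ?S" if f: "f \<in> ?S" "f \<noteq> 0" for f
  proof -
    obtain c where c: "f = Poly_Mapping.single 0 c" using f by blast
    then have "c \<noteq> 0" using f by auto
    then have "1 = f * Poly_Mapping.single 0 (inverse c)" by (simp add: c mult_single)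
    then have "dvd_in ?S f 1" unfolding dvd_in_def by blast
    then show ?thesis using f by (intro prime_products.unit)
  qed
  then show ?thesis unfolding polys_in_empty by unfold_locales
qed

text \<open>
  The hypothesis makes the image closed under sums, so that only monomials need preimages.
\<close>

lemma polys_in_insert:
  assumes "subdomain ((\<lambda>p. poly p (var i)) ` polys_over (polys_in V :: ('n, 'k::field_char_0) mpoly set))"
  shows "polys_in (insert i V) =
    (\<lambda>p. poly p (var i)) ` polys_over (polys_in V :: ('n, 'k) mpoly set)" (is "_ = ?I")
proof (intro equalityI subsetI)
  interpret I: subdomain ?I by fact
  fix f :: "('n, 'k) mpoly" assume f: "f \<in> polys_in (insert i V)"
  have "Poly_Mapping.single J a \<in> ?I" if J: "Poly_Mapping.keys J \<subseteq> insert i V" for J and a :: 'k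
  proof -
    define k where "k = Poly_Mapping.lookup J i"
    define J' where "J' = J - Poly_Mapping.single i k"
    have J': "J = J' + Poly_Mapping.single i k"
      by (rule poly_mapping_eqI) (auto simp: J'_def k_def lookup_add lookup_minus lookup_single when_def)
    have "Poly_Mapping.keys J' \<subseteq> V"
    proof
      fix j assume "j \<in> Poly_Mapping.keys J'"
      then have "Poly_Mapping.lookup J j \<noteq> 0" "j \<noteq> i"
        by (auto simp: J'_def k_def in_keys_iff lookup_minus lookup_single when_def)
      then have "j \<in> Poly_Mapping.keys J" by (simp add: in_keys_iff)
      then show "j \<in> V" using J \<open>j \<noteq> i\<close> by blast
    qed
    then have "monom (Poly_Mapping.single J' a) k \<in> polys_over (polys_in V)"
      by (auto simp: polys_over_def polys_in_def)
    moreover have "poly (monom (Poly_Mapping.single J' a) k) (var i) = Poly_Mapping.single J a"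
      by (simp only: poly_monom var_power mult_single J') simp
    ultimately show ?thesis by (metis imageI)
  qed
  then have "(\<Sum>J\<in>Poly_Mapping.keys f. Poly_Mapping.single J (Poly_Mapping.lookup f J)) \<in> ?I"
    using f by (intro I.sum_mem) (auto simp: polys_in_def)
  then show "f \<in> ?I" by (simp only: sum_monomials)
next
  fix f :: "('n, 'k) mpoly" assume "f \<in> ?I"
  then obtain p where p: "p \<in> polys_over (polys_in V)" "f = poly p (var i)" by blast
  have "coeff p k \<in> polys_in (insert i V)" for k
    using polys_overD[OF p(1)] polys_in_mono[of V "insert i V"] by blast
  moreover have "Poly_Mapping.single (Poly_Mapping.single i k) 1 \<in> polys_in (insert i V)" for k
    by (auto simp: polys_in_def)
  ultimately show "f \<in> polys_in (insert i V)"
    unfolding p(2) poly_altdef var_power by (intro polys_in_sum polys_in_mult)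
qed

theorem factorial_subring_polys_in:
  "finite V \<Longrightarrow> factorial_subring (polys_in V :: ('n, 'k::field_char_0) mpoly set)"
proof (induction V rule: finite_induct)
  case empty
  show ?case by (rule factorial_subring_constants)
next
  case (insert i V)
  have "factorial_subring
      ((\<lambda>p. poly p (var i)) ` polys_over (polys_in V :: ('n, 'k) mpoly set))"
  proof (rule factorial_subring_image)
    show "factorial_subring (polys_over (polys_in V :: ('n, 'k) mpoly set))"
      using insert.IH by (rule factorial_subring.factorial_subring_polys_over)
  qed (use poly_var_eq_0D insert.hyps in auto)
  then show ?case using polys_in_insert factorial_subring.axioms(1) by metis
qed

lemma factorial_subring_mpoly: "factorial_subring (UNIV :: ('n::finite, 'k::field_char_0) mpoly set)"
  using factorial_subring_polys_in[of "UNIV :: 'n set"] by (simp add: polys_in_def)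

lemma mpoly_no_zero_divisors:
  fixes f g :: "('n::finite, 'k::field_char_0) mpoly"
  shows "f * g = 0 \<Longrightarrow> f = 0 \<or> g = 0"
  using subdomain.no_zero_divisors[OF factorial_subring.axioms(1)[OF factorial_subring_mpoly]] by blast

lemma dvd_in_UNIV: "dvd_in UNIV a b \<longleftrightarrow> a dvd b"
  by (auto simp: dvd_in_def dvd_def)

text \<open>
  Every prime factor of \<open>a\<close> divides \<open>c * b\<close> and, being no unit, not \<open>b\<close>; so it can be cancelled
  from both \<open>a\<close> and \<open>c\<close>.
\<close>

lemma coprime_dvd_mult:
  fixes a b c :: "('n::finite, 'k::field_char_0) mpoly"
  assumes "a \<noteq> 0" and "\<And>r. r dvd a \<Longrightarrow> r dvd b \<Longrightarrow> r dvd 1" and "a dvd c * b"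
  shows "a dvd c"
proof -
  interpret factorial_subring "UNIV :: ('n, 'k) mpoly set" by (rule factorial_subring_mpoly)
  have "a \<in> prime_products UNIV" using factorization assms(1) by blast
  then show ?thesis using assms(2,3)
  proof (induction arbitrary: c rule: prime_products.induct)
    case (unit u)
    then have "u dvd 1" by (simp add: dvd_in_UNIV)
    then show ?case by (rule dvd_trans) (rule one_dvd)
  next
    case (prime p a)
    have p: "p \<noteq> 0" "\<not> p dvd 1" "\<And>x y. p dvd x * y \<Longrightarrow> p dvd x \<or> p dvd y"
      using prime.hyps(1) by (auto simp: prime_in_def dvd_in_UNIV)
    have "\<not> p dvd b" using prime.prems(1)[of p] p(2) by auto
    moreover have "p dvd c * b" using prime.prems(2) by (rule dvd_mult_left)
    ultimately have "p dvd c" using p(3) by blast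
    then obtain c' where c: "c = p * c'" by (rule dvdE)
    obtain q where "c * b = p * a * q" using prime.prems(2) by (rule dvdE)
    then have "p * (c' * b) = p * (a * q)" by (simp add: c mult.assoc)
    then have "c' * b = a * q" using mult_cancel[of p "c' * b" "a * q"] p(1) by simp
    then have "a dvd c' * b" by simp
    moreover have "r dvd 1" if "r dvd a" "r dvd b" for r
      using prime.prems(1)[OF dvd_mult[OF that(1)] that(2)] .
    ultimately have "a dvd c'" using prime.IH by blast
    then show ?case by (simp add: c mult_dvd_mono)
  qed
qed

section \<open>The symbol of a composition\<close>

text \<open>
  A strict bound makes the zero polynomial the only element for \<open>k = 0\<close>; a bound by the order itself
  would not distinguish it from a constant.
\<close>

definition degree_below :: "nat \<Rightarrow> (('n::finite \<Rightarrow>\<^sub>0 nat) \<Rightarrow>\<^sub>0 'k::field_char_0) set" where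
  "degree_below k = {f. \<forall>J\<in>Poly_Mapping.keys f. multi_degree J < k}"

text \<open>
  Unlike the symbol, a homogeneous part of fixed degree is additive.
\<close>

definition hom_part :: "nat \<Rightarrow> (('n::finite \<Rightarrow>\<^sub>0 nat) \<Rightarrow>\<^sub>0 'k::field_char_0) \<Rightarrow> ('n \<Rightarrow>\<^sub>0 nat) \<Rightarrow>\<^sub>0 'k" where
  "hom_part k f =
     (\<Sum>J | J \<in> Poly_Mapping.keys f \<and> multi_degree J = k. Poly_Mapping.single J (Poly_Mapping.lookup f J))"

lemma multi_degree_add: "multi_degree (J + K) = multi_degree J + multi_degree K"
  by (simp add: multi_degree_def lookup_add sum.distrib)

lemma multi_degree_single [simp]: "multi_degree (Poly_Mapping.single i k) = k"
  by (simp add: multi_degree_def lookup_single when_def)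

lemma degree_below_add:
  "f \<in> degree_below k \<Longrightarrow> g \<in> degree_below k \<Longrightarrow> f + g \<in> degree_below k"
  unfolding degree_below_def using Poly_Mapping.keys_add[of f g] by blast

lemma degree_below_diff:
  "f \<in> degree_below k \<Longrightarrow> g \<in> degree_below k \<Longrightarrow> f - g \<in> degree_below k"
  unfolding degree_below_def using keys_diff[of f g] by blast

lemma degree_below_sum: "(\<And>x. x \<in> A \<Longrightarrow> f x \<in> degree_below k) \<Longrightarrow> sum f A \<in> degree_below k"
proof (induction A rule: infinite_finite_induct)
  case (insert x A)
  then have "f x + sum f A \<in> degree_below k" by (intro degree_below_add) auto
  then show ?case using insert.hyps by simp
qed (simp_all add: degree_below_def)

lemma degree_below_mono: "f \<in> degree_below k \<Longrightarrow> k \<le> l \<Longrightarrow> f \<in> degree_below l"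
  by (force simp: degree_below_def)

lemma degree_below_single_mult:
  assumes "f \<in> degree_below k"
  shows "Poly_Mapping.single J a * f \<in> degree_below (multi_degree J + k)"
proof -
  have "multi_degree K < multi_degree J + k"
    if K: "K \<in> Poly_Mapping.keys (Poly_Mapping.single J a * f)" for K
  proof -
    obtain I where "K = J + I" "I \<in> Poly_Mapping.keys f"
      using K keys_mult[of "Poly_Mapping.single J a" f] by (auto split: if_splits)
    then show ?thesis using assms by (auto simp: degree_below_def multi_degree_add)
  qed
  then show ?thesis by (simp add: degree_below_def)
qed

lemma degree_below_scale:
  "f \<in> degree_below k \<Longrightarrow> Poly_Mapping.map ((*) a) f \<in> degree_below k"
  by (auto simp: degree_below_def in_keys_iff lookup_map_scale)

lemma lookup_hom_part:
  "Poly_Mapping.lookup (hom_part k f) J = (if multi_degree J = k then Poly_Mapping.lookup f J else 0)"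
proof -
  have "finite {J \<in> Poly_Mapping.keys f. multi_degree J = k}" by simp
  then show ?thesis
    by (auto simp: hom_part_def lookup_sum lookup_single when_def in_keys_iff)
qed

lemma lpdo_symbol_eq_hom_part: "lpdo_symbol L = hom_part (lpdo_order L) L"
  by (simp add: lpdo_symbol_def hom_part_def)

lemma hom_part_zero [simp]: "hom_part k 0 = 0"
  by (rule poly_mapping_eqI) (simp add: lookup_hom_part)

lemma hom_part_add: "hom_part k (f + g) = hom_part k f + hom_part k g"
  by (rule poly_mapping_eqI) (simp add: lookup_hom_part lookup_add)

lemma hom_part_diff: "hom_part k (f - g) = hom_part k f - hom_part k g"
  by (rule poly_mapping_eqI) (simp add: lookup_hom_part lookup_minus)

lemma hom_part_single:
  "hom_part k (Poly_Mapping.single J a) = (if multi_degree J = k then Poly_Mapping.single J a else 0)"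
  by (rule poly_mapping_eqI) (auto simp: lookup_hom_part lookup_single when_def)

lemma hom_part_hom_part: "hom_part k (hom_part l f) = (if k = l then hom_part l f else 0)"
  by (rule poly_mapping_eqI) (auto simp: lookup_hom_part)

lemma hom_part_eq_0: "f \<in> degree_below l \<Longrightarrow> l \<le> k \<Longrightarrow> hom_part k f = 0"
  by (rule poly_mapping_eqI) (force simp: lookup_hom_part degree_below_def in_keys_iff)

lemma hom_part_degree_below: "hom_part k f \<in> degree_below (Suc k)"
  by (auto simp: degree_below_def in_keys_iff lookup_hom_part split: if_splits)

lemma degree_below_Suc:
  assumes "f \<in> degree_below (Suc k)" "hom_part k f = 0"
  shows "f \<in> degree_below k"
proof -
  have "multi_degree J < k" if J: "J \<in> Poly_Mapping.keys f" for J
  proof -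
    have "multi_degree J \<noteq> k" using J arg_cong[OF assms(2), of "\<lambda>g. Poly_Mapping.lookup g J"]
      by (auto simp: lookup_hom_part in_keys_iff)
    then show ?thesis using assms(1) J by (fastforce simp: degree_below_def)
  qed
  then show ?thesis by (simp add: degree_below_def)
qed

lemma degree_below_order: "L \<in> degree_below (Suc (lpdo_order L))"
  by (auto simp: degree_below_def lpdo_order_def less_Suc_eq_le)

lemma symbol_nonzero:
  assumes "L \<noteq> 0" shows "lpdo_symbol L \<noteq> 0"
proof
  assume 0: "lpdo_symbol L = 0"
  have "lpdo_order L \<in> multi_degree ` Poly_Mapping.keys L"
    unfolding lpdo_order_def using assms by (intro Max_in) auto
  then obtain J where J: "J \<in> Poly_Mapping.keys L" "multi_degree J = lpdo_order L" by auto
  have "Poly_Mapping.lookup (lpdo_symbol L) J \<noteq> 0"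
    using J by (simp add: lpdo_symbol_eq_hom_part lookup_hom_part in_keys_iff)
  then show False using 0 by simp
qed

lemma hom_part_mult:
  "hom_part k (f * g) = (\<Sum>i\<le>k. hom_part i f * hom_part (k - i) g)"
proof (induction f rule: lpdo_induct)
  case (single I a)
  show ?case
  proof (induction g rule: lpdo_induct)
    case (single J b)
    have "hom_part i (Poly_Mapping.single I a) * hom_part (k - i) (Poly_Mapping.single J b) =
        (if i = multi_degree I then (if k = multi_degree I + multi_degree J
           then Poly_Mapping.single (I + J) (a * b) else 0) else 0)" if "i \<le> k" for i
      using that by (auto simp: hom_part_single mult_single)
    then show ?case by (auto simp: mult_single hom_part_single multi_degree_add)
  next
    case (add g h)
    then show ?case by (simp add: distrib_left hom_part_add sum.distrib)
  qed
next
  case (add f h)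
  then show ?case by (simp add: distrib_right hom_part_add sum.distrib)
qed

lemma hom_part_mult_top:
  assumes "f \<in> degree_below (Suc m)" "g \<in> degree_below (Suc n)"
  shows "hom_part (m + n) (f * g) = hom_part m f * hom_part n g"
proof -
  have "hom_part i f * hom_part (m + n - i) g = (if i = m then hom_part m f * hom_part n g else 0)" for i
    using hom_part_eq_0[OF assms(1), of i] hom_part_eq_0[OF assms(2), of "m + n - i"]
    by (cases i m rule: linorder_cases) auto
  then show ?thesis by (simp add: hom_part_mult)
qed

lemma hom_part_homogeneous_mult:
  "hom_part l (hom_part m f * g) = (if m \<le> l then hom_part m f * hom_part (l - m) g else 0)"
proof -
  have "hom_part i (hom_part m f) * hom_part (l - i) g =
      (if i = m then hom_part m f * hom_part (l - m) g else 0)" for i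
    by (simp add: hom_part_hom_part)
  then show ?thesis by (simp add: hom_part_mult)
qed

context commuting_derivations
begin

lemma lpdo_mult_diff_left: "(L - M) \<circ>\<^bsub>d\<^esub> N = (L \<circ>\<^bsub>d\<^esub> N) - (M \<circ>\<^bsub>d\<^esub> N)"
  using lpdo_mult_add_left[of "L - M" M d N] by simp

lemma lpdo_mult_diff_right: "L \<circ>\<^bsub>d\<^esub> (M - N) = (L \<circ>\<^bsub>d\<^esub> M) - (L \<circ>\<^bsub>d\<^esub> N)"
  using lpdo_mult_add_right[of L "M - N" N] by simp

lemma degree_below_map_deriv: "f \<in> degree_below k \<Longrightarrow> Poly_Mapping.map (d i) f \<in> degree_below k"
  by (auto simp: degree_below_def in_keys_iff lookup_map_deriv)

text \<open>
  Moving \<open>D\<^sub>i\<close> past a coefficient produces the main term \<open>X\<^sub>i * M\<close> of the commutative product and a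
  derivative of the coefficients, which does not raise the order.
\<close>

lemma DJ_left_lower_order:
  assumes "M \<in> degree_below (Suc n)"
  shows "lpdo_DJ_left d J M - Poly_Mapping.single J 1 * M \<in> degree_below (multi_degree J + n)"
proof (induction J rule: multi_index_induct)
  case zero
  show ?case by (simp add: degree_below_def)
next
  case (step J i)
  let ?X = "Poly_Mapping.single (Poly_Mapping.single i 1) 1 :: ('n, 'k) mpoly"
  let ?R = "lpdo_DJ_left d J M - Poly_Mapping.single J 1 * M"
  let ?k = "multi_degree J + n"
  have "Poly_Mapping.single J 1 * M \<in> degree_below (Suc ?k)"
    using degree_below_single_mult[OF assms] by simp
  then have "?R + Poly_Mapping.single J 1 * M \<in> degree_below (Suc ?k)"
    using degree_below_mono[OF step] by (intro degree_below_add) auto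
  then have "Poly_Mapping.map (d i) (lpdo_DJ_left d J M) \<in> degree_below (Suc ?k)"
    by (simp add: degree_below_map_deriv)
  moreover have "?X * ?R \<in> degree_below (Suc ?k)"
    using degree_below_single_mult[OF step, of "Poly_Mapping.single i 1" 1] by simp
  moreover have "lpdo_DJ_left d (J + Poly_Mapping.single i 1) M
        - Poly_Mapping.single (J + Poly_Mapping.single i 1) 1 * M =
      ?X * ?R + Poly_Mapping.map (d i) (lpdo_DJ_left d J M)"
  proof -
    have X: "Poly_Mapping.single (J + Poly_Mapping.single i 1) 1 = ?X * Poly_Mapping.single J 1"
      by (simp add: mult_single add.commute)
    show ?thesis
      unfolding DJ_left_add_single lpdo_D_left_def X by (simp only: right_diff_distrib mult.assoc) simp
  qed
  moreover have "multi_degree (J + Poly_Mapping.single i 1) + n = Suc ?k"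
    by (simp add: multi_degree_add)
  ultimately show ?case by (simp only: degree_below_add)
qed

text \<open>
  Composition and commutative product agree up to lower order; this is why symbols are
  multiplicative.
\<close>

lemma lpdo_mult_lower_order:
  assumes "L \<in> degree_below (Suc m)" "M \<in> degree_below (Suc n)"
  shows "L \<circ>\<^bsub>d\<^esub> M - L * M \<in> degree_below (m + n)"
proof -
  let ?a = "Poly_Mapping.lookup L"
  have "L * M = (\<Sum>J\<in>Poly_Mapping.keys L. Poly_Mapping.single J (?a J) * M)"
    by (metis sum_monomials sum_distrib_right)
  also have "\<dots> = (\<Sum>J\<in>Poly_Mapping.keys L. Poly_Mapping.map ((*) (?a J)) (Poly_Mapping.single J 1 * M))"
    by (simp add: mult_map_scale_conv_mult mult.assoc[symmetric] mult_single)
  finally have "L \<circ>\<^bsub>d\<^esub> M - L * M = (\<Sum>J\<in>Poly_Mapping.keys L. Poly_Mapping.map ((*) (?a J))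
      (lpdo_DJ_left d J M - Poly_Mapping.single J 1 * M))"
    by (simp add: lpdo_mult_def sum_subtractf[symmetric] mult_map_scale_conv_mult right_diff_distrib)
  also have "\<dots> \<in> degree_below (m + n)"
  proof (intro degree_below_sum degree_below_scale)
    fix J assume "J \<in> Poly_Mapping.keys L"
    then have "multi_degree J \<le> m" using assms(1) by (auto simp: degree_below_def)
    then show "lpdo_DJ_left d J M - Poly_Mapping.single J 1 * M \<in> degree_below (m + n)"
      using degree_below_mono[OF DJ_left_lower_order[OF assms(2)]] by simp
  qed
  finally show ?thesis .
qed

lemma hom_part_lpdo_mult:
  assumes "L \<in> degree_below (Suc m)" "M \<in> degree_below (Suc n)"
  shows "hom_part (m + n) (L \<circ>\<^bsub>d\<^esub> M) = hom_part m L * hom_part n M"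
  using hom_part_eq_0[OF lpdo_mult_lower_order[OF assms] order_refl] hom_part_mult_top[OF assms]
  by (simp add: hom_part_diff)

lemma degree_below_lpdo_mult:
  assumes "L \<in> degree_below (Suc m)" "M \<in> degree_below (Suc n)"
  shows "L \<circ>\<^bsub>d\<^esub> M \<in> degree_below (Suc (m + n))"
proof -
  have "L * M \<in> degree_below (Suc (m + n))"
  proof -
    have "multi_degree K < Suc (m + n)" if "K \<in> Poly_Mapping.keys (L * M)" for K
      using that keys_mult[of L M] assms by (fastforce simp: degree_below_def multi_degree_add)
    then show ?thesis by (simp add: degree_below_def)
  qed
  then have "(L \<circ>\<^bsub>d\<^esub> M - L * M) + L * M \<in> degree_below (Suc (m + n))"
    using degree_below_mono[OF lpdo_mult_lower_order[OF assms]] by (intro degree_below_add) auto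
  then show ?thesis by simp
qed

section \<open>Factoring a common multiple\<close>

lemma zero_lpdo_mult [simp]: "0 \<circ>\<^bsub>d\<^esub> L = 0"
  by (simp add: lpdo_mult_def)

lemma lpdo_mult_zero [simp]: "L \<circ>\<^bsub>d\<^esub> 0 = 0"
  using lpdo_mult_diff_right[of L 0 0] by simp

text \<open>
  Both sides of the equation have a nonzero part in the degree predicted by their factors, so the two
  predicted degrees agree and the symbols can be compared there.  The bound \<open>l\<close> takes the place of the
  order of \<open>L\<close>.
\<close>

lemma symbol_dvd:
  fixes L F M G :: "('n, 'k) lpdo"
  assumes coprime: "\<And>C :: ('n, 'k) mpoly. C dvd lpdo_symbol F \<Longrightarrow> C dvd lpdo_symbol M \<Longrightarrow> C dvd 1"
    and nz: "F \<noteq> 0" "M \<noteq> 0"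
    and L: "L \<in> degree_below (Suc l)" "hom_part l L \<noteq> 0"
    and eq: "L \<circ>\<^bsub>d\<^esub> F = M \<circ>\<^bsub>d\<^esub> G"
  shows "lpdo_symbol M dvd hom_part l L"
proof -
  have LF: "hom_part (l + lpdo_order F) (L \<circ>\<^bsub>d\<^esub> F) = hom_part l L * lpdo_symbol F"
    using hom_part_lpdo_mult[OF L(1) degree_below_order] by (simp add: lpdo_symbol_eq_hom_part)
  have MG: "hom_part (lpdo_order M + lpdo_order G) (M \<circ>\<^bsub>d\<^esub> G) = lpdo_symbol M * lpdo_symbol G"
    using hom_part_lpdo_mult[OF degree_below_order degree_below_order]
    by (simp add: lpdo_symbol_eq_hom_part)
  have LF0: "hom_part l L * lpdo_symbol F \<noteq> 0"
    using mpoly_no_zero_divisors L(2) symbol_nonzero nz by blast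
  then have "G \<noteq> 0" using LF eq by auto
  then have MG0: "lpdo_symbol M * lpdo_symbol G \<noteq> 0"
    using mpoly_no_zero_divisors symbol_nonzero nz by blast
  have "l + lpdo_order F \<le> lpdo_order M + lpdo_order G"
    using hom_part_eq_0[OF degree_below_lpdo_mult[OF degree_below_order degree_below_order]] LF LF0 eq
    by (metis not_less_eq_eq)
  moreover have "lpdo_order M + lpdo_order G \<le> l + lpdo_order F"
    using hom_part_eq_0[OF degree_below_lpdo_mult[OF L(1) degree_below_order]] MG MG0 eq
    by (metis not_less_eq_eq)
  ultimately have "hom_part l L * lpdo_symbol F = lpdo_symbol M * lpdo_symbol G"
    using LF MG eq by simp
  then have "lpdo_symbol M dvd hom_part l L * lpdo_symbol F" by simp
  then show ?thesis
    using coprime_dvd_mult[OF symbol_nonzero[OF nz(2)]] coprime by blast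
qed

text \<open>
  Division of \<open>L\<close> by \<open>M\<close> and of \<open>G\<close> by \<open>F\<close> with a common quotient, by induction on a strict bound for
  the order of \<open>L\<close>.
\<close>

lemma common_multiple_factors:
  fixes L F M G :: "('n, 'k) lpdo"
  assumes coprime: "\<And>C :: ('n, 'k) mpoly. C dvd lpdo_symbol F \<Longrightarrow> C dvd lpdo_symbol M \<Longrightarrow> C dvd 1"
    and eq: "L \<circ>\<^bsub>d\<^esub> F = M \<circ>\<^bsub>d\<^esub> G"
  shows "\<exists>N. L \<circ>\<^bsub>d\<^esub> F = M \<circ>\<^bsub>d\<^esub> N \<circ>\<^bsub>d\<^esub> F"
proof (cases "F = 0 \<or> M = 0")
  case True
  then show ?thesis using eq by auto
next
  case False
  have "\<exists>N. L \<circ>\<^bsub>d\<^esub> F = M \<circ>\<^bsub>d\<^esub> N \<circ>\<^bsub>d\<^esub> F" if "L \<in> degree_below l" for l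
    using that eq
  proof (induction l arbitrary: L G)
    case 0
    then have "L = 0" by (simp add: degree_below_def)
    then show ?case by (intro exI[of _ 0]) simp
  next
    case (Suc l)
    define m where "m = lpdo_order M"
    have M: "M \<in> degree_below (Suc m)" "lpdo_symbol M = hom_part m M"
      unfolding m_def by (rule degree_below_order, rule lpdo_symbol_eq_hom_part)
    show ?case
    proof (cases "hom_part l L = 0")
      case True
      then show ?thesis using Suc degree_below_Suc by blast
    next
      case nonzero: False
      have "lpdo_symbol M dvd hom_part l L"
        using symbol_dvd[OF coprime _ _ Suc.prems(1) nonzero Suc.prems(2)] False by blast
      then obtain q where q: "hom_part l L = hom_part m M * q" unfolding M(2) by (auto simp: dvd_def)
      \<comment> \<open>The quotient of homogeneous polynomials may be replaced by its homogeneous part, which bounds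
        its order as an operator.\<close>
      define N where "N = hom_part (l - m) q"
      have "hom_part l (hom_part l L) = hom_part l (hom_part m M * q)" by (simp only: q)
      then have l: "m \<le> l" and top: "hom_part l L = hom_part m M * N"
        using nonzero by (auto simp: hom_part_hom_part hom_part_homogeneous_mult N_def split: if_splits)
      have N: "N \<in> degree_below (Suc (l - m))" "hom_part (l - m) N = N"
        by (simp_all add: N_def hom_part_degree_below hom_part_hom_part)
      have "hom_part l (M \<circ>\<^bsub>d\<^esub> N) = hom_part m M * N" "M \<circ>\<^bsub>d\<^esub> N \<in> degree_below (Suc l)"
        using hom_part_lpdo_mult[OF M(1) N(1)] degree_below_lpdo_mult[OF M(1) N(1)] l N(2) by simp_all
      then have "L - M \<circ>\<^bsub>d\<^esub> N \<in> degree_below (Suc l)" "hom_part l (L - M \<circ>\<^bsub>d\<^esub> N) = 0"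
        using Suc.prems(1) top degree_below_diff by (auto simp: hom_part_diff)
      then have "L - M \<circ>\<^bsub>d\<^esub> N \<in> degree_below l" by (rule degree_below_Suc)
      moreover have "(L - M \<circ>\<^bsub>d\<^esub> N) \<circ>\<^bsub>d\<^esub> F = M \<circ>\<^bsub>d\<^esub> (G - N \<circ>\<^bsub>d\<^esub> F)"
        by (simp add: lpdo_mult_diff_left lpdo_mult_diff_right lpdo_mult_assoc Suc.prems(2))
      ultimately obtain N' where "(L - M \<circ>\<^bsub>d\<^esub> N) \<circ>\<^bsub>d\<^esub> F = M \<circ>\<^bsub>d\<^esub> N' \<circ>\<^bsub>d\<^esub> F"
        using Suc.IH by blast
      then have "L \<circ>\<^bsub>d\<^esub> F = M \<circ>\<^bsub>d\<^esub> (N + N') \<circ>\<^bsub>d\<^esub> F"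
        by (simp add: lpdo_mult_diff_left lpdo_mult_add_left lpdo_mult_add_right diff_eq_eq add.commute)
      then show ?thesis ..
    qed
  qed
  then show ?thesis using degree_below_order by blast
qed

end

theorem corollary3p3:
  fixes d :: "'n::finite \<Rightarrow> 'k::field_char_0 \<Rightarrow> 'k"
    and A L F M G :: "('n, 'k) lpdo"
  assumes "commuting_derivations d"
    and gcd_1: "\<forall>C :: ('n, 'k) mpoly. C dvd lpdo_symbol F \<longrightarrow> C dvd lpdo_symbol M \<longrightarrow> C dvd 1"
  shows "(L \<circ>\<^bsub>d\<^esub> F = A \<and> A = M \<circ>\<^bsub>d\<^esub> G \<longrightarrow> (\<exists>N. A = M \<circ>\<^bsub>d\<^esub> N \<circ>\<^bsub>d\<^esub> F)) \<and>
         (F \<circ>\<^bsub>d\<^esub> L = A \<and> A = G \<circ>\<^bsub>d\<^esub> M \<longrightarrow> (\<exists>N. A = F \<circ>\<^bsub>d\<^esub> N \<circ>\<^bsub>d\<^esub> M))"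
proof (intro conjI impI)
  interpret commuting_derivations d by fact
  show "\<exists>N. A = M \<circ>\<^bsub>d\<^esub> N \<circ>\<^bsub>d\<^esub> F" if "L \<circ>\<^bsub>d\<^esub> F = A \<and> A = M \<circ>\<^bsub>d\<^esub> G"
    using common_multiple_factors[of F M L G] gcd_1 that by auto
  \<comment> \<open>Exchanging \<open>F\<close> with \<open>M\<close> and \<open>L\<close> with \<open>G\<close> turns the second part into the first.\<close>
  show "\<exists>N. A = F \<circ>\<^bsub>d\<^esub> N \<circ>\<^bsub>d\<^esub> M" if "F \<circ>\<^bsub>d\<^esub> L = A \<and> A = G \<circ>\<^bsub>d\<^esub> M"
    using common_multiple_factors[of M F G L] gcd_1 that by auto
qed

end
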